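(* Let $\underline{C}$ be a triangulated category that has all small coproducts. Let $\mathcal{P}\subset \operatorname{Obj}\underline{C}$ be a weakly negative class of compact objects of $\underline{C}$, i.e. every element of $\mathcal{P}$ is compact and $\underline{C}(P,P'[i])=\{0\}$ for all $P,P'\in\mathcal{P}$ and all $i>1$. Set $A=[\mathcal{P}]^{\mathrm{cl}}$ and $B=[\bigcup_{i\ge 0}\mathcal{P}[i]]^{\mathrm{cl}}$ (big extension-closures). 1. Then $B=A\star B[1]$. 2. Assume moreover that $\mathcal{P}=\bigcup_{0\le i\le n}\mathcal{P}_i$ for some integer $n\ge 0$ and some subclasses $\mathcal{P}_i$ such that $\underline{C}(P,P'[1])=\{0\}$ for all $P\in \mathcal{P}_i$ and $P'\in\mathcal{P}_j$ whenever $i\le j$. For $0\le i\le n$ let $\mathcal{Q}_i$ be the class of all objects of $\underline{C}$ that are (small) coproducts of elements of $\mathcal{P}_i$. Then $\mathcal{Q}_0\star\mathcal{Q}_1\star\dots\star\mathcal{Q}_n=A$.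
   Context: All coproducts are small; coproducts are taken up to isomorphism, over arbitrary set-indexed families (repetitions allowed, and the empty coproduct is $0$). $\underline{C}(X,Y)$ denotes the group of morphisms from $X$ to $Y$, and $[i]$ denotes the $i$-th shift; for a class $\mathcal{P}$ of objects, $\mathcal{P}[i]=\{P[i]: P\in\mathcal{P}\}$. An object $M$ is compact if the functor $\underline{C}(M,-):\underline{C}\to \mathrm{Ab}$ respects coproducts. For objects $X,Y,Z$, the object $Z$ is an extension of $Y$ by $X$ if there is a distinguished triangle $X\to Z\to Y\to X[1]$. For classes $\mathcal{X},\mathcal{Y}\subset\operatorname{Obj}\underline{C}$, $\mathcal{X}\star\mathcal{Y}$ is the class of all extensions of elements of $\mathcal{Y}$ by elements of $\mathcal{X}$, i.e. of all $Z$ fitting into a distinguished triangle $X\to Z\to Y\to X[1]$ with $X\in\mathcal{X}$, $Y\in\mathcal{Y}$. The operation $\star$ is associative on classes of objects, so iterated $\star$-products may be written without parentheses. A class of objects is extension-closed if it contains $0$ and is closed with respect to extensions; it is smashing if it is closed with respect to small coproducts in $\underline{C}$. The big extension-closure $[\mathcal{P}]^{\mathrm{cl}}$ of a class $\mathcal{P}$ is the smallest smashing extension-closed subclass of $\operatorname{Obj}\underline{C}$ that contains $\mathcal{P}$. *)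

theory Defs
  imports "HOL-Algebra.Free_Abelian_Groups"
begin

unbundle cardinal_syntax

section \<open>Triangulated categories\<close>

text \<open>
  The groups of morphisms are groups in the sense of HOL-Algebra and hence written
  multiplicatively: \<open>\<otimes>\<close>, \<open>\<one>\<close> and \<open>inv\<close> in \<open>Mor C X Y\<close> stand for the
  sum, the zero morphism and the negative of morphisms.
  The predicate \<open>Dist C X Y Z f g h\<close> says that
  \<open>X \<rightarrow> Y \<rightarrow> Z \<rightarrow> X[1]\<close>, with the arrows \<open>f\<close>, \<open>g\<close>, \<open>h\<close>, is distinguished.
\<close>

record ('o, 'm) tri_cat =
  Obj :: "'o set"
  Mor :: "'o \<Rightarrow> 'o \<Rightarrow> 'm monoid"
  Comp :: "'m \<Rightarrow> 'm \<Rightarrow> 'm"  (infixr \<open>\<cdot>\<index>\<close> 75)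
  Ident :: "'o \<Rightarrow> 'm"
  Sh :: "'o \<Rightarrow> 'o"
  ShM :: "'m \<Rightarrow> 'm"
  Dist :: "'o \<Rightarrow> 'o \<Rightarrow> 'o \<Rightarrow> 'm \<Rightarrow> 'm \<Rightarrow> 'm \<Rightarrow> bool"

abbreviation arrows :: "('o, 'm) tri_cat \<Rightarrow> 'o \<Rightarrow> 'o \<Rightarrow> 'm set" where
  "arrows C X Y \<equiv> carrier (Mor C X Y)"

abbreviation zero_arrow :: "('o, 'm) tri_cat \<Rightarrow> 'o \<Rightarrow> 'o \<Rightarrow> 'm" where
  "zero_arrow C X Y \<equiv> \<one>\<^bsub>Mor C X Y\<^esub>"

definition zero_object :: "('o, 'm) tri_cat \<Rightarrow> 'o \<Rightarrow> bool" where
  "zero_object C N \<longleftrightarrow> N \<in> Obj C \<and>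
     (\<forall>X\<in>Obj C. (\<exists>!f. f \<in> arrows C N X) \<and> (\<exists>!f. f \<in> arrows C X N))"

definition iso_arrow :: "('o, 'm) tri_cat \<Rightarrow> 'o \<Rightarrow> 'o \<Rightarrow> 'm \<Rightarrow> bool" where
  "iso_arrow C X Y f \<longleftrightarrow> f \<in> arrows C X Y \<and>
     (\<exists>g\<in>arrows C Y X. g \<cdot>\<^bsub>C\<^esub> f = Ident C X \<and> f \<cdot>\<^bsub>C\<^esub> g = Ident C Y)"

locale preadditive_category =
  fixes C :: "('o, 'm) tri_cat" (structure)
  assumes Mor_comm_group:
      "\<lbrakk>X \<in> Obj C; Y \<in> Obj C\<rbrakk> \<Longrightarrow> comm_group (Mor C X Y)"
    and Ident_closed: "X \<in> Obj C \<Longrightarrow> Ident C X \<in> arrows C X X"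
    and Comp_closed:
      "\<lbrakk>X \<in> Obj C; Y \<in> Obj C; Z \<in> Obj C; f \<in> arrows C X Y; g \<in> arrows C Y Z\<rbrakk>
        \<Longrightarrow> g \<cdot> f \<in> arrows C X Z"
    and Comp_Ident_right:
      "\<lbrakk>X \<in> Obj C; Y \<in> Obj C; f \<in> arrows C X Y\<rbrakk> \<Longrightarrow> f \<cdot> Ident C X = f"
    and Comp_Ident_left:
      "\<lbrakk>X \<in> Obj C; Y \<in> Obj C; f \<in> arrows C X Y\<rbrakk> \<Longrightarrow> Ident C Y \<cdot> f = f"
    and Comp_assoc:
      "\<lbrakk>W \<in> Obj C; X \<in> Obj C; Y \<in> Obj C; Z \<in> Obj C;
        f \<in> arrows C W X; g \<in> arrows C X Y; h \<in> arrows C Y Z\<rbrakk>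
        \<Longrightarrow> (h \<cdot> g) \<cdot> f = h \<cdot> (g \<cdot> f)"
    and Comp_add_left:
      "\<lbrakk>X \<in> Obj C; Y \<in> Obj C; Z \<in> Obj C;
        f \<in> arrows C X Y; g \<in> arrows C Y Z; g' \<in> arrows C Y Z\<rbrakk>
        \<Longrightarrow> (g \<otimes>\<^bsub>Mor C Y Z\<^esub> g') \<cdot> f = (g \<cdot> f) \<otimes>\<^bsub>Mor C X Z\<^esub> (g' \<cdot> f)"
    and Comp_add_right:
      "\<lbrakk>X \<in> Obj C; Y \<in> Obj C; Z \<in> Obj C;
        f \<in> arrows C X Y; f' \<in> arrows C X Y; g \<in> arrows C Y Z\<rbrakk>
        \<Longrightarrow> g \<cdot> (f \<otimes>\<^bsub>Mor C X Y\<^esub> f') = (g \<cdot> f) \<otimes>\<^bsub>Mor C X Z\<^esub> (g \<cdot> f')"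

locale additive_category = preadditive_category +
  assumes zero_object_exists: "\<exists>N. zero_object C N"
    and biproduct_exists:
      "\<lbrakk>X \<in> Obj C; Y \<in> Obj C\<rbrakk> \<Longrightarrow>
        \<exists>Z\<in>Obj C. \<exists>i\<in>arrows C X Z. \<exists>j\<in>arrows C Y Z. \<exists>p\<in>arrows C Z X. \<exists>q\<in>arrows C Z Y.
          p \<cdot> i = Ident C X \<and> q \<cdot> j = Ident C Y \<and>
          p \<cdot> j = zero_arrow C Y X \<and> q \<cdot> i = zero_arrow C X Y \<and>
          (i \<cdot> p) \<otimes>\<^bsub>Mor C Z Z\<^esub> (j \<cdot> q) = Ident C Z"

text \<open>
  The shift is an additive autoequivalence, not necessarily an automorphism.
\<close>

locale shifted_additive_category = additive_category +
  assumes Sh_closed: "X \<in> Obj C \<Longrightarrow> Sh C X \<in> Obj C"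
    and ShM_hom:
      "\<lbrakk>X \<in> Obj C; Y \<in> Obj C\<rbrakk> \<Longrightarrow> ShM C \<in> hom (Mor C X Y) (Mor C (Sh C X) (Sh C Y))"
    and ShM_Ident: "X \<in> Obj C \<Longrightarrow> ShM C (Ident C X) = Ident C (Sh C X)"
    and ShM_Comp:
      "\<lbrakk>X \<in> Obj C; Y \<in> Obj C; Z \<in> Obj C; f \<in> arrows C X Y; g \<in> arrows C Y Z\<rbrakk>
        \<Longrightarrow> ShM C (g \<cdot> f) = ShM C g \<cdot> ShM C f"
    and ShM_fully_faithful:
      "\<lbrakk>X \<in> Obj C; Y \<in> Obj C\<rbrakk>
        \<Longrightarrow> bij_betw (ShM C) (arrows C X Y) (arrows C (Sh C X) (Sh C Y))"
    and Sh_essentially_surjective: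
      "Y \<in> Obj C \<Longrightarrow> \<exists>X\<in>Obj C. \<exists>f. iso_arrow C (Sh C X) Y f"

locale triangulated_category = shifted_additive_category +
  assumes Dist_triangle:
      "Dist C X Y Z f g h \<Longrightarrow>
        X \<in> Obj C \<and> Y \<in> Obj C \<and> Z \<in> Obj C \<and>
        f \<in> arrows C X Y \<and> g \<in> arrows C Y Z \<and> h \<in> arrows C Z (Sh C X)"
    and Dist_iso:
      "\<lbrakk>Dist C X Y Z f g h; X' \<in> Obj C; Y' \<in> Obj C; Z' \<in> Obj C;
        f' \<in> arrows C X' Y'; g' \<in> arrows C Y' Z'; h' \<in> arrows C Z' (Sh C X');
        iso_arrow C X X' a; iso_arrow C Y Y' b; iso_arrow C Z Z' c;
        b \<cdot> f = f' \<cdot> a; c \<cdot> g = g' \<cdot> b; ShM C a \<cdot> h = h' \<cdot> c\<rbrakk>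
        \<Longrightarrow> Dist C X' Y' Z' f' g' h'"
    and Dist_Ident:
      "\<lbrakk>X \<in> Obj C; zero_object C N\<rbrakk> \<Longrightarrow>
        Dist C X X N (Ident C X) (zero_arrow C X N) (zero_arrow C N (Sh C X))"
    and Dist_complete:
      "\<lbrakk>X \<in> Obj C; Y \<in> Obj C; f \<in> arrows C X Y\<rbrakk> \<Longrightarrow> \<exists>Z g h. Dist C X Y Z f g h"
    and Dist_rotate:
      "\<lbrakk>X \<in> Obj C; Y \<in> Obj C; Z \<in> Obj C;
        f \<in> arrows C X Y; g \<in> arrows C Y Z; h \<in> arrows C Z (Sh C X)\<rbrakk> \<Longrightarrow>
        Dist C X Y Z f g h \<longleftrightarrow>
        Dist C Y Z (Sh C X) g h (inv\<^bsub>Mor C (Sh C X) (Sh C Y)\<^esub> (ShM C f))"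
    and Dist_morphism:
      "\<lbrakk>Dist C X Y Z f g h; Dist C X' Y' Z' f' g' h';
        a \<in> arrows C X X'; b \<in> arrows C Y Y'; b \<cdot> f = f' \<cdot> a\<rbrakk> \<Longrightarrow>
        \<exists>c\<in>arrows C Z Z'. c \<cdot> g = g' \<cdot> b \<and> ShM C a \<cdot> h = h' \<cdot> c"
    and Dist_octahedron:
      "\<lbrakk>Dist C X Y Z' f i i'; Dist C Y Z X' g j j'; Dist C X Z Y' (g \<cdot> f) k k'\<rbrakk> \<Longrightarrow>
        \<exists>u\<in>arrows C Z' Y'. \<exists>v\<in>arrows C Y' X'.
          Dist C Z' Y' X' u v (ShM C i \<cdot> j') \<and>
          u \<cdot> i = k \<cdot> g \<and> k' \<cdot> u = i' \<and> v \<cdot> k = j \<and> j' \<cdot> v = ShM C f \<cdot> k'"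


section \<open>Smallness and coproducts\<close>

text \<open>
  HOL has no distinction between sets and classes. Smallness is measured by an
  uncountable regular cardinal \<open>\<kappa>\<close>: a set is small if its cardinality is less than
  \<open>\<kappa>\<close>. If \<open>\<kappa>\<close> is the cardinality of a Grothendieck universe, these are (up to
  bijection) the sets of that universe. Every small set has a copy inside the field of
  \<open>\<kappa>\<close>, so that it suffices to consider index sets in the type underlying \<open>\<kappa>\<close>.
\<close>

definition smallness_cardinal :: "'u rel \<Rightarrow> bool" where
  "smallness_cardinal \<kappa> \<longleftrightarrow> Card_order \<kappa> \<and> regularCard \<kappa> \<and> natLeq <o \<kappa>"

definition small :: "'u rel \<Rightarrow> 'u set \<Rightarrow> bool" where
  "small \<kappa> I \<longleftrightarrow> |I| <o \<kappa>"

definition is_coproduct ::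
    "('o, 'm) tri_cat \<Rightarrow> 'i set \<Rightarrow> ('i \<Rightarrow> 'o) \<Rightarrow> 'o \<Rightarrow> ('i \<Rightarrow> 'm) \<Rightarrow> bool" where
  "is_coproduct C I X Z \<iota> \<longleftrightarrow>
     X \<in> I \<rightarrow> Obj C \<and> Z \<in> Obj C \<and> (\<forall>k\<in>I. \<iota> k \<in> arrows C (X k) Z) \<and>
     (\<forall>W\<in>Obj C. \<forall>\<phi>. (\<forall>k\<in>I. \<phi> k \<in> arrows C (X k) W) \<longrightarrow>
        (\<exists>!u. u \<in> arrows C Z W \<and> (\<forall>k\<in>I. u \<cdot>\<^bsub>C\<^esub> \<iota> k = \<phi> k)))"

definition has_small_coproducts :: "('o, 'm) tri_cat \<Rightarrow> 'u rel \<Rightarrow> bool" where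
  "has_small_coproducts C \<kappa> \<longleftrightarrow>
     (\<forall>I X. small \<kappa> I \<and> X \<in> I \<rightarrow> Obj C \<longrightarrow> (\<exists>Z \<iota>. is_coproduct C I X Z \<iota>))"

definition small_coproducts_of :: "('o, 'm) tri_cat \<Rightarrow> 'u rel \<Rightarrow> 'o set \<Rightarrow> 'o set" where
  "small_coproducts_of C \<kappa> \<P> =
     {Z. \<exists>I X \<iota>. small \<kappa> I \<and> X \<in> I \<rightarrow> \<P> \<and> is_coproduct C I X Z \<iota>}"

text \<open>
  The functor of morphisms out of \<open>M\<close> respects a coproduct if the canonical homomorphism
  from the direct sum of the groups \<open>Mor C M (X k)\<close> to \<open>Mor C M Z\<close> is an isomorphism.
\<close>

definition compact_object :: "('o, 'm) tri_cat \<Rightarrow> 'u rel \<Rightarrow> 'o \<Rightarrow> bool" where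
  "compact_object C \<kappa> M \<longleftrightarrow> M \<in> Obj C \<and>
     (\<forall>I X Z \<iota>. small \<kappa> I \<and> is_coproduct C I X Z \<iota> \<longrightarrow>
        (\<lambda>x. gfinprod (Mor C M Z) (\<lambda>k. \<iota> k \<cdot>\<^bsub>C\<^esub> x k) I)
          \<in> iso (sum_group I (\<lambda>k. Mor C M (X k))) (Mor C M Z))"


section \<open>Classes of objects\<close>

definition shift_class :: "('o, 'm) tri_cat \<Rightarrow> nat \<Rightarrow> 'o set \<Rightarrow> 'o set" where
  "shift_class C i \<P> = (Sh C ^^ i) ` \<P>"

definition star :: "('o, 'm) tri_cat \<Rightarrow> 'o set \<Rightarrow> 'o set \<Rightarrow> 'o set" where
  "star C \<X> \<Y> = {Z. \<exists>X\<in>\<X>. \<exists>Y\<in>\<Y>. \<exists>f g h. Dist C X Z Y f g h}"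

fun iterated_star :: "('o, 'm) tri_cat \<Rightarrow> (nat \<Rightarrow> 'o set) \<Rightarrow> nat \<Rightarrow> 'o set" where
  "iterated_star C \<Q> 0 = \<Q> 0"
| "iterated_star C \<Q> (Suc n) = star C (iterated_star C \<Q> n) (\<Q> (Suc n))"

definition extension_closed :: "('o, 'm) tri_cat \<Rightarrow> 'o set \<Rightarrow> bool" where
  "extension_closed C \<P> \<longleftrightarrow> (\<forall>N. zero_object C N \<longrightarrow> N \<in> \<P>) \<and> star C \<P> \<P> \<subseteq> \<P>"

definition smashing :: "('o, 'm) tri_cat \<Rightarrow> 'u rel \<Rightarrow> 'o set \<Rightarrow> bool" where
  "smashing C \<kappa> \<P> \<longleftrightarrow> small_coproducts_of C \<kappa> \<P> \<subseteq> \<P>"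

definition big_extension_closure :: "('o, 'm) tri_cat \<Rightarrow> 'u rel \<Rightarrow> 'o set \<Rightarrow> 'o set" where
  "big_extension_closure C \<kappa> \<P> =
     \<Inter>{\<S>. \<S> \<subseteq> Obj C \<and> \<P> \<subseteq> \<S> \<and> smashing C \<kappa> \<S> \<and> extension_closed C \<S>}"

definition hom_vanishes :: "('o, 'm) tri_cat \<Rightarrow> 'o \<Rightarrow> 'o \<Rightarrow> bool" where
  "hom_vanishes C X Y \<longleftrightarrow> arrows C X Y = {zero_arrow C X Y}"

definition weakly_negative :: "('o, 'm) tri_cat \<Rightarrow> 'o set \<Rightarrow> bool" where
  "weakly_negative C \<P> \<longleftrightarrow>
     (\<forall>P\<in>\<P>. \<forall>P'\<in>\<P>. \<forall>i>1. hom_vanishes C P ((Sh C ^^ i) P'))"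

end

theory Submission
  imports Defs
begin

text \<open>
  Call a class closed if it is smashing and extension-closed. The heart of the matter: if
  \<open>\<X>\<close> and \<open>\<Y>\<close> are closed and there are no non-zero morphisms from \<open>\<X>\<close> to \<open>\<Y>[1]\<close>, then
  \<open>\<X> \<star> \<Y>\<close> is closed. It is smashing because coproducts of distinguished triangles are
  distinguished. It is extension-closed because an extension of an object of \<open>\<X>\<close> by one of
  \<open>\<Y>\<close> splits, whence \<open>\<Y> \<star> \<X> \<subseteq> \<X> \<star> \<Y>\<close>, so that associativity gives
  \<open>\<X> \<star> \<Y> \<star> \<X> \<star> \<Y> \<subseteq> \<X> \<star> \<X> \<star> \<Y> \<star> \<Y> \<subseteq> \<X> \<star> \<Y>\<close>.
  For the first claim take \<open>\<X> = A\<close> and \<open>\<Y> = B[1]\<close>; for the second one add the factors \<open>\<Q>\<^sub>i\<close>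
  one at a time. Both orthogonality conditions are inherited from \<open>\<P>\<close>: the objects right
  orthogonal to a compact object and those left orthogonal to any object form closed classes.
\<close>

section \<open>Preadditive categories\<close>

context preadditive_category
begin

text \<open>In both claims the product lies in the closure because the closure contains every factor
  and absorbs extensions; the first claim uses here that \<open>B\<close> is stable under the shift.
  Conversely, a closed product contains the closure once it contains the generators:
  \<open>P\<close> lies in \<open>A\<close> and \<open>P[i + 1]\<close> in \<open>B[1]\<close>. The
  orthogonality needed there is from \<open>A\<close> to \<open>B[1][1]\<close>, so it concerns
  shifts by at least 2, which is what weak negativity controls. Compactness is known for elements of
  \<P>, not for the objects built from them. Orthogonality is therefore spread in a fixed order:
  first over the targets, with a source in \<P> fixed, then over the sources, with the target fixed.
  In the second claim the condition with \<open>i = j\<close> makes extensions inside each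
  \<open>\<Q>\<^sub>i\<close> split, so that the factors are closed; the pairs with
  \<open>i < j\<close> serve for the products. The shift is only an autoequivalence, so the literal
  image \<open>B[1]\<close> may miss isomorphic objects. The closed product is formed with its
  closure under isomorphism, and literal shifts return at the very end.\<close>

text \<open>The axioms ask for the objects and for the arrow separately; bundling them makes typing
  facts composable.\<close>

definition arr :: "'m \<Rightarrow> 'o \<Rightarrow> 'o \<Rightarrow> bool" where
  "arr f X Y \<longleftrightarrow> X \<in> Obj C \<and> Y \<in> Obj C \<and> f \<in> arrows C X Y"

text \<open>This is \<open>f - g\<close> in additive notation.\<close>

definition diff :: "'o \<Rightarrow> 'o \<Rightarrow> 'm \<Rightarrow> 'm \<Rightarrow> 'm" where
  "diff X Y f g = f \<otimes>\<^bsub>Mor C X Y\<^esub> inv\<^bsub>Mor C X Y\<^esub> g"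

lemma arr_dom: "arr f X Y \<Longrightarrow> X \<in> Obj C"
  and arr_cod: "arr f X Y \<Longrightarrow> Y \<in> Obj C"
  by (auto simp: arr_def)

lemma arr_Comp: "\<lbrakk>arr f X Y; arr g Y Z\<rbrakk> \<Longrightarrow> arr (g \<cdot> f) X Z"
  unfolding arr_def using Comp_closed by blast

lemma arr_Ident: "X \<in> Obj C \<Longrightarrow> arr (Ident C X) X X"
  unfolding arr_def using Ident_closed by blast

lemma arr_zero: "\<lbrakk>X \<in> Obj C; Y \<in> Obj C\<rbrakk> \<Longrightarrow> arr (zero_arrow C X Y) X Y"
  unfolding arr_def using Mor_comm_group[of X Y] by (simp add: comm_groupE(2))

lemma Mor_group: "\<lbrakk>X \<in> Obj C; Y \<in> Obj C\<rbrakk> \<Longrightarrow> group (Mor C X Y)"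
  using Mor_comm_group comm_group.axioms(2) by blast

lemma Comp_assoc': "\<lbrakk>arr f W X; arr g X Y; arr h Y Z\<rbrakk> \<Longrightarrow> (h \<cdot> g) \<cdot> f = h \<cdot> (g \<cdot> f)"
  unfolding arr_def using Comp_assoc by blast

lemma Comp_Ident_right': "arr f X Y \<Longrightarrow> f \<cdot> Ident C X = f"
  unfolding arr_def using Comp_Ident_right by blast

lemma Comp_Ident_left': "arr f X Y \<Longrightarrow> Ident C Y \<cdot> f = f"
  unfolding arr_def using Comp_Ident_left by blast

lemma precomp_hom: "\<lbrakk>arr f X Y; Z \<in> Obj C\<rbrakk> \<Longrightarrow> group_hom (Mor C Y Z) (Mor C X Z) (\<lambda>g. g \<cdot> f)"
  unfolding group_hom_def group_hom_axioms_def arr_def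
  by (auto simp: Mor_group hom_def Comp_closed Comp_add_left)

lemma postcomp_hom: "\<lbrakk>arr g Y Z; X \<in> Obj C\<rbrakk> \<Longrightarrow> group_hom (Mor C X Y) (Mor C X Z) (\<lambda>f. g \<cdot> f)"
  unfolding group_hom_def group_hom_axioms_def arr_def
  by (auto simp: Mor_group hom_def Comp_closed Comp_add_right)

lemma Comp_zero_left: "\<lbrakk>arr f X Y; Z \<in> Obj C\<rbrakk> \<Longrightarrow> zero_arrow C Y Z \<cdot> f = zero_arrow C X Z"
  using group_hom.hom_one[OF precomp_hom] by blast

lemma Comp_zero_right: "\<lbrakk>arr g Y Z; X \<in> Obj C\<rbrakk> \<Longrightarrow> g \<cdot> zero_arrow C X Y = zero_arrow C X Z"
  using group_hom.hom_one[OF postcomp_hom] by blast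

lemma arr_inv: "arr f X Y \<Longrightarrow> arr (inv\<^bsub>Mor C X Y\<^esub> f) X Y"
  by (simp add: arr_def group.inv_closed[OF Mor_group])

lemma inv_inv_arr: "arr f X Y \<Longrightarrow> inv\<^bsub>Mor C X Y\<^esub> (inv\<^bsub>Mor C X Y\<^esub> f) = f"
  by (simp add: arr_def group.inv_inv[OF Mor_group])

lemma inv_zero_arrow:
  "\<lbrakk>X \<in> Obj C; Y \<in> Obj C\<rbrakk> \<Longrightarrow> inv\<^bsub>Mor C X Y\<^esub> (zero_arrow C X Y) = zero_arrow C X Y"
  by (simp add: monoid.inv_one[OF group.is_monoid[OF Mor_group]])

lemma Comp_inv_left:
  "\<lbrakk>arr f X Y; arr g Y Z\<rbrakk> \<Longrightarrow> (inv\<^bsub>Mor C Y Z\<^esub> g) \<cdot> f = inv\<^bsub>Mor C X Z\<^esub> (g \<cdot> f)"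
  using group_hom.hom_inv[OF precomp_hom, of f X Y Z g] by (auto simp: arr_def)

lemma Comp_inv_right:
  "\<lbrakk>arr f X Y; arr g Y Z\<rbrakk> \<Longrightarrow> g \<cdot> (inv\<^bsub>Mor C X Y\<^esub> f) = inv\<^bsub>Mor C X Z\<^esub> (g \<cdot> f)"
  using group_hom.hom_inv[OF postcomp_hom, of g Y Z X f] by (auto simp: arr_def)

lemma arr_add: "\<lbrakk>arr f X Y; arr g X Y\<rbrakk> \<Longrightarrow> arr (f \<otimes>\<^bsub>Mor C X Y\<^esub> g) X Y"
  by (simp add: arr_def comm_groupE(1)[OF Mor_comm_group])

lemma arr_diff: "\<lbrakk>arr f X Y; arr g X Y\<rbrakk> \<Longrightarrow> arr (diff X Y f g) X Y"
  unfolding diff_def by (blast intro: arr_add arr_inv)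

lemma Comp_add_left':
  "\<lbrakk>arr f X Y; arr g Y Z; arr g' Y Z\<rbrakk>
    \<Longrightarrow> (g \<otimes>\<^bsub>Mor C Y Z\<^esub> g') \<cdot> f = (g \<cdot> f) \<otimes>\<^bsub>Mor C X Z\<^esub> (g' \<cdot> f)"
  unfolding arr_def using Comp_add_left by blast

lemma Comp_add_right':
  "\<lbrakk>arr f X Y; arr f' X Y; arr g Y Z\<rbrakk>
    \<Longrightarrow> g \<cdot> (f \<otimes>\<^bsub>Mor C X Y\<^esub> f') = (g \<cdot> f) \<otimes>\<^bsub>Mor C X Z\<^esub> (g \<cdot> f')"
  unfolding arr_def using Comp_add_right by blast

lemma Comp_diff_left:
  "\<lbrakk>arr f X Y; arr g Y Z; arr g' Y Z\<rbrakk> \<Longrightarrow> diff Y Z g g' \<cdot> f = diff X Z (g \<cdot> f) (g' \<cdot> f)"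
  unfolding diff_def by (simp add: Comp_add_left' arr_inv Comp_inv_left)

lemma Comp_diff_right:
  "\<lbrakk>arr f X Y; arr f' X Y; arr g Y Z\<rbrakk> \<Longrightarrow> g \<cdot> diff X Y f f' = diff X Z (g \<cdot> f) (g \<cdot> f')"
  unfolding diff_def by (simp add: Comp_add_right' arr_inv Comp_inv_right)

lemma diff_self: "arr f X Y \<Longrightarrow> diff X Y f f = zero_arrow C X Y"
  by (simp add: diff_def arr_def group.r_inv[OF Mor_group])

lemma diff_zero: "arr f X Y \<Longrightarrow> diff X Y f (zero_arrow C X Y) = f"
  by (simp add: diff_def arr_def inv_zero_arrow monoid.r_one[OF group.is_monoid[OF Mor_group]])

lemma diff_eq_zeroD: "\<lbrakk>arr f X Y; arr g X Y; diff X Y f g = zero_arrow C X Y\<rbrakk> \<Longrightarrow> f = g"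
  unfolding diff_def arr_def
  using group.inv_equality[OF Mor_group, of X Y f "inv\<^bsub>Mor C X Y\<^esub> g"]
  by (simp add: group.inv_closed[OF Mor_group] group.inv_inv[OF Mor_group])

lemma diff_diff_self: "\<lbrakk>arr f X Y; arr g X Y\<rbrakk> \<Longrightarrow> diff X Y f (diff X Y f g) = g"
proof -
  assume *: "arr f X Y" "arr g X Y"
  then interpret G: comm_group "Mor C X Y"
    unfolding arr_def using Mor_comm_group by blast
  show ?thesis
    using * unfolding diff_def arr_def
    by (simp add: G.inv_mult G.m_assoc[symmetric])
qed

lemma diff_add_cancel: "\<lbrakk>arr f X Y; arr g X Y\<rbrakk> \<Longrightarrow> diff X Y f g \<otimes>\<^bsub>Mor C X Y\<^esub> g = f"
proof -
  assume *: "arr f X Y" "arr g X Y"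
  then interpret G: comm_group "Mor C X Y"
    unfolding arr_def using Mor_comm_group by blast
  show ?thesis
    using * unfolding diff_def arr_def by (simp add: G.m_assoc)
qed

lemma add_zero_right: "arr f X Y \<Longrightarrow> f \<otimes>\<^bsub>Mor C X Y\<^esub> zero_arrow C X Y = f"
  and add_zero_left: "arr f X Y \<Longrightarrow> zero_arrow C X Y \<otimes>\<^bsub>Mor C X Y\<^esub> f = f"
  by (simp_all add: arr_def monoid.r_one[OF group.is_monoid[OF Mor_group]]
      monoid.l_one[OF group.is_monoid[OF Mor_group]])

lemma hom_vanishes_iff:
  "\<lbrakk>X \<in> Obj C; Y \<in> Obj C\<rbrakk> \<Longrightarrow>
    hom_vanishes C X Y \<longleftrightarrow> (\<forall>f. arr f X Y \<longrightarrow> f = zero_arrow C X Y)"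
  using arr_zero[of X Y] unfolding hom_vanishes_def arr_def by auto

text \<open>An equation in place of a universal property: this is how zero objects pass through the
  shift in both directions.\<close>

lemma zero_object_iff: "zero_object C N \<longleftrightarrow> N \<in> Obj C \<and> Ident C N = zero_arrow C N N"
proof
  assume "zero_object C N"
  then show "N \<in> Obj C \<and> Ident C N = zero_arrow C N N"
    unfolding zero_object_def using arr_zero[of N N] arr_Ident[of N] unfolding arr_def by blast
next
  assume N: "N \<in> Obj C \<and> Ident C N = zero_arrow C N N"
  have "f = zero_arrow C N X" if "arr f N X" for f X
    using that N Comp_Ident_right'[OF that] Comp_zero_right[OF that] by simp
  moreover have "f = zero_arrow C X N" if "arr f X N" for f X
    using that N Comp_Ident_left'[OF that] Comp_zero_left[OF that] by simp
  ultimately show "zero_object C N"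
    unfolding zero_object_def using N arr_zero unfolding arr_def by metis
qed

lemma zero_object_unique_out: "\<lbrakk>zero_object C N; arr f N X; arr g N X\<rbrakk> \<Longrightarrow> f = g"
  and zero_object_unique_in: "\<lbrakk>zero_object C N; arr f X N; arr g X N\<rbrakk> \<Longrightarrow> f = g"
  unfolding zero_object_def arr_def by blast+

lemma zero_object_Obj: "zero_object C N \<Longrightarrow> N \<in> Obj C"
  by (simp add: zero_object_def)

lemma iso_arrow_Ident: "X \<in> Obj C \<Longrightarrow> iso_arrow C X X (Ident C X)"
  unfolding iso_arrow_def using Ident_closed Comp_Ident_left by blast

lemma iso_arrowE:
  assumes "iso_arrow C X Y f" "X \<in> Obj C" "Y \<in> Obj C"
  obtains g where "arr f X Y" "arr g Y X" "g \<cdot> f = Ident C X" "f \<cdot> g = Ident C Y"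
    "iso_arrow C Y X g"
  using assms unfolding iso_arrow_def arr_def by blast

lemma iso_arrowI:
  "\<lbrakk>arr f X Y; arr g Y X; g \<cdot> f = Ident C X; f \<cdot> g = Ident C Y\<rbrakk> \<Longrightarrow> iso_arrow C X Y f"
  unfolding iso_arrow_def arr_def by blast

lemma Comp_cancel_left:
  "\<lbrakk>arr f X Y; arr g Y Z; arr g' Z Y; g' \<cdot> g = Ident C Y\<rbrakk> \<Longrightarrow> g' \<cdot> (g \<cdot> f) = f"
  using Comp_assoc'[of f X Y g Z g' Y] by (simp add: Comp_Ident_left')

section \<open>Coproducts by their universal property\<close>

lemma coproductD:
  assumes "is_coproduct C I X Z \<iota>"
  shows "Z \<in> Obj C" and "\<And>k. k \<in> I \<Longrightarrow> arr (\<iota> k) (X k) Z"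
  using assms unfolding is_coproduct_def arr_def by auto

lemma coproduct_universal:
  "\<lbrakk>is_coproduct C I X Z \<iota>; W \<in> Obj C; \<forall>k\<in>I. \<phi> k \<in> arrows C (X k) W\<rbrakk>
    \<Longrightarrow> \<exists>!u. u \<in> arrows C Z W \<and> (\<forall>k\<in>I. u \<cdot> \<iota> k = \<phi> k)"
  by (simp add: is_coproduct_def)

lemma coproduct_lift:
  assumes "is_coproduct C I X Z \<iota>" "W \<in> Obj C" "\<And>k. k \<in> I \<Longrightarrow> arr (\<phi> k) (X k) W"
  obtains u where "arr u Z W" "\<forall>k\<in>I. u \<cdot> \<iota> k = \<phi> k"
proof -
  have "\<forall>k\<in>I. \<phi> k \<in> arrows C (X k) W" using assms(3) by (simp add: arr_def)
  from coproduct_universal[OF assms(1,2) this] obtain u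
    where "u \<in> arrows C Z W" "\<forall>k\<in>I. u \<cdot> \<iota> k = \<phi> k" by blast
  then show ?thesis using that[of u] coproductD[OF assms(1)] assms(2) by (simp add: arr_def)
qed

lemma coproduct_eqI:
  assumes Z: "is_coproduct C I X Z \<iota>" and u: "arr u Z W" and v: "arr v Z W"
    and eq: "\<And>k. k \<in> I \<Longrightarrow> u \<cdot> \<iota> k = v \<cdot> \<iota> k"
  shows "u = v"
proof -
  have "u \<cdot> \<iota> k \<in> arrows C (X k) W" if "k \<in> I" for k
    using arr_Comp[OF coproductD(2)[OF Z that] u] by (simp add: arr_def)
  then have "\<forall>k\<in>I. u \<cdot> \<iota> k \<in> arrows C (X k) W" by (rule ballI)
  from coproduct_universal[OF Z arr_cod[OF u] this]
  obtain w where w: "\<And>x. x \<in> arrows C Z W \<and> (\<forall>k\<in>I. x \<cdot> \<iota> k = u \<cdot> \<iota> k) \<Longrightarrow> x = w"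
    by (elim ex1E) blast
  have "u = w" by (rule w) (use u in \<open>simp add: arr_def\<close>)
  moreover have "v = w" by (rule w) (use v eq in \<open>simp add: arr_def\<close>)
  ultimately show ?thesis by simp
qed

text \<open>Additivity reduces uniqueness to the zero morphism: the difference of two mediating
  morphisms vanishes on all injections.\<close>

lemma coproductI:
  assumes Z: "Z \<in> Obj C" and \<iota>: "\<And>k. k \<in> I \<Longrightarrow> arr (\<iota> k) (X k) Z"
    and ex: "\<And>W \<phi>. \<lbrakk>W \<in> Obj C; \<And>k. k \<in> I \<Longrightarrow> arr (\<phi> k) (X k) W\<rbrakk>
      \<Longrightarrow> \<exists>u. arr u Z W \<and> (\<forall>k\<in>I. u \<cdot> \<iota> k = \<phi> k)"
    and uniq: "\<And>W u. \<lbrakk>arr u Z W; \<And>k. k \<in> I \<Longrightarrow> u \<cdot> \<iota> k = zero_arrow C (X k) W\<rbrakk>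
      \<Longrightarrow> u = zero_arrow C Z W"
  shows "is_coproduct C I X Z \<iota>"
  unfolding is_coproduct_def
proof (intro conjI ballI allI impI)
  show "X \<in> I \<rightarrow> Obj C" "Z \<in> Obj C" using Z \<iota> by (auto simp: arr_def)
  show "\<iota> k \<in> arrows C (X k) Z" if "k \<in> I" for k using \<iota>[OF that] by (simp add: arr_def)
  fix W \<phi> assume W: "W \<in> Obj C" and "\<forall>k\<in>I. \<phi> k \<in> arrows C (X k) W"
  then have "arr (\<phi> k) (X k) W" if "k \<in> I" for k using that \<iota> by (auto simp: arr_def)
  from ex[OF W this] obtain u where u: "arr u Z W" "\<forall>k\<in>I. u \<cdot> \<iota> k = \<phi> k" by blast
  have "v = u" if v: "v \<in> arrows C Z W" "\<forall>k\<in>I. v \<cdot> \<iota> k = \<phi> k" for v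
  proof -
    have av: "arr v Z W" using v Z W by (simp add: arr_def)
    have "diff Z W v u = zero_arrow C Z W"
    proof (rule uniq)
      fix k assume k: "k \<in> I"
      show "diff Z W v u \<cdot> \<iota> k = zero_arrow C (X k) W"
        using Comp_diff_left[OF \<iota>[OF k] av u(1)] u v k diff_self[OF arr_Comp[OF \<iota>[OF k] u(1)]]
        by simp
    qed (rule arr_diff[OF av u(1)])
    then show ?thesis using diff_eq_zeroD av u by blast
  qed
  then show "\<exists>!u. u \<in> arrows C Z W \<and> (\<forall>k\<in>I. u \<cdot> \<iota> k = \<phi> k)"
    using u unfolding arr_def by blast
qed

lemma coproduct_unique:
  assumes Z: "is_coproduct C I X Z \<iota>" and Z': "is_coproduct C I X Z' \<iota>'"
  shows "\<exists>u. iso_arrow C Z Z' u \<and> (\<forall>k\<in>I. u \<cdot> \<iota> k = \<iota>' k)"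
proof -
  obtain u where u: "arr u Z Z'" "\<forall>k\<in>I. u \<cdot> \<iota> k = \<iota>' k"
    by (rule coproduct_lift[OF Z coproductD[OF Z']])
  obtain v where v: "arr v Z' Z" "\<forall>k\<in>I. v \<cdot> \<iota>' k = \<iota> k"
    by (rule coproduct_lift[OF Z' coproductD[OF Z]])
  have "v \<cdot> u = Ident C Z"
    by (rule coproduct_eqI[OF Z arr_Comp[OF u(1) v(1)] arr_Ident[OF coproductD(1)[OF Z]]])
      (simp add: Comp_assoc'[OF coproductD(2)[OF Z] u(1) v(1)] u(2) v(2)
        Comp_Ident_left'[OF coproductD(2)[OF Z]])
  moreover have "u \<cdot> v = Ident C Z'"
    by (rule coproduct_eqI[OF Z' arr_Comp[OF v(1) u(1)] arr_Ident[OF coproductD(1)[OF Z']]])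
      (simp add: Comp_assoc'[OF coproductD(2)[OF Z'] v(1) u(1)] u(2) v(2)
        Comp_Ident_left'[OF coproductD(2)[OF Z']])
  ultimately show ?thesis using iso_arrowI u v by blast
qed

text \<open>Needed for families whose members are merely isomorphic to shifts.\<close>

lemma coproduct_precomp_iso:
  assumes Z: "is_coproduct C I X Z \<iota>" and X': "\<And>k. k \<in> I \<Longrightarrow> X' k \<in> Obj C"
    and e: "\<And>k. k \<in> I \<Longrightarrow> iso_arrow C (X' k) (X k) (e k)"
  shows "is_coproduct C I X' Z (\<lambda>k. \<iota> k \<cdot> e k)"
proof -
  note \<iota> = coproductD[OF Z]
  have "\<exists>d. arr (e k) (X' k) (X k) \<and> arr d (X k) (X' k) \<and> e k \<cdot> d = Ident C (X k) \<and>
      d \<cdot> e k = Ident C (X' k)" if "k \<in> I" for k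
    by (rule iso_arrowE[OF e[OF that] X'[OF that] arr_dom[OF \<iota>(2)[OF that]]]) blast
  then obtain d where d: "arr (e k) (X' k) (X k)" "arr (d k) (X k) (X' k)"
    "e k \<cdot> d k = Ident C (X k)" "d k \<cdot> e k = Ident C (X' k)" if "k \<in> I" for k
    by metis
  show ?thesis
  proof (rule coproductI)
    show "Z \<in> Obj C" by fact
    show "arr (\<iota> k \<cdot> e k) (X' k) Z" if "k \<in> I" for k using arr_Comp d \<iota> that by blast
  next
    fix W \<phi> assume W: "W \<in> Obj C" and \<phi>: "\<And>k. k \<in> I \<Longrightarrow> arr (\<phi> k) (X' k) W"
    have "arr (\<phi> k \<cdot> d k) (X k) W" if "k \<in> I" for k using arr_Comp d \<phi> that by blast
    then obtain u where u: "arr u Z W" "\<forall>k\<in>I. u \<cdot> \<iota> k = \<phi> k \<cdot> d k"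
      by (rule coproduct_lift[OF Z W])
    have "u \<cdot> (\<iota> k \<cdot> e k) = \<phi> k" if "k \<in> I" for k
      using Comp_assoc'[OF d(1)[OF that] \<iota>(2)[OF that] u(1)] bspec[OF u(2) that]
        Comp_assoc'[OF d(1)[OF that] d(2)[OF that] \<phi>[OF that]] d(4)[OF that]
        Comp_Ident_right'[OF \<phi>[OF that]] by simp
    then show "\<exists>u. arr u Z W \<and> (\<forall>k\<in>I. u \<cdot> (\<iota> k \<cdot> e k) = \<phi> k)" using u by blast
  next
    fix W u assume u: "arr u Z W" "\<And>k. k \<in> I \<Longrightarrow> u \<cdot> (\<iota> k \<cdot> e k) = zero_arrow C (X' k) W"
    show "u = zero_arrow C Z W"
    proof (rule coproduct_eqI[OF Z u(1)])
      show "arr (zero_arrow C Z W) Z W" using arr_zero u arr_def by blast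
      fix k assume k: "k \<in> I"
      have "u \<cdot> \<iota> k = (u \<cdot> (\<iota> k \<cdot> e k)) \<cdot> d k"
        using Comp_assoc'[OF d(2)[OF k] arr_Comp[OF d(1)[OF k] \<iota>(2)[OF k]] u(1)]
          Comp_assoc'[OF d(2)[OF k] d(1)[OF k] \<iota>(2)[OF k]] d(3)[OF k]
          Comp_Ident_right'[OF \<iota>(2)[OF k]] by simp
      also have "\<dots> = zero_arrow C (X k) W"
        using u(2)[OF k] Comp_zero_left[OF d(2)[OF k] arr_cod[OF u(1)]] by simp
      finally show "u \<cdot> \<iota> k = zero_arrow C Z W \<cdot> \<iota> k"
        using Comp_zero_left[OF \<iota>(2)[OF k] arr_cod[OF u(1)]] by simp
    qed
  qed
qed

lemma empty_coproduct_iff: "is_coproduct C {} X N \<iota> \<longleftrightarrow> zero_object C N"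
proof
  assume N: "is_coproduct C {} X N \<iota>"
  show "zero_object C N"
    unfolding zero_object_iff
    using coproduct_eqI[OF N arr_Ident arr_zero] coproductD[OF N] by simp
next
  assume N: "zero_object C N"
  show "is_coproduct C {} X N \<iota>"
  proof (rule coproductI)
    show "N \<in> Obj C" by (rule zero_object_Obj[OF N])
    then show "\<exists>u. arr u N W \<and> (\<forall>k\<in>{}. u \<cdot> \<iota> k = \<phi> k)" if "W \<in> Obj C" for W \<phi>
      using arr_zero that by auto
    show "u = zero_arrow C N W" if "arr u N W" for W u
      using zero_object_unique_out[OF N that] arr_zero arr_dom[OF that] arr_cod[OF that] by simp
  qed simp
qed

end

section \<open>The shift\<close>

context shifted_additive_category
begin

lemma arr_ShM: "arr f X Y \<Longrightarrow> arr (ShM C f) (Sh C X) (Sh C Y)"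
  using ShM_hom[of X Y] by (auto simp: arr_def Sh_closed hom_def)

lemma ShM_group_hom:
  "\<lbrakk>X \<in> Obj C; Y \<in> Obj C\<rbrakk> \<Longrightarrow> group_hom (Mor C X Y) (Mor C (Sh C X) (Sh C Y)) (ShM C)"
  by (simp add: group_hom_def group_hom_axioms_def Mor_group Sh_closed ShM_hom)

lemma ShM_zero:
  "\<lbrakk>X \<in> Obj C; Y \<in> Obj C\<rbrakk> \<Longrightarrow> ShM C (zero_arrow C X Y) = zero_arrow C (Sh C X) (Sh C Y)"
  using group_hom.hom_one[OF ShM_group_hom] .

lemma ShM_Comp': "\<lbrakk>arr f X Y; arr g Y Z\<rbrakk> \<Longrightarrow> ShM C (g \<cdot> f) = ShM C g \<cdot> ShM C f"
  unfolding arr_def using ShM_Comp by blast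

lemma ShM_inj: "\<lbrakk>arr f X Y; arr g X Y; ShM C f = ShM C g\<rbrakk> \<Longrightarrow> f = g"
  using ShM_fully_faithful[of X Y] by (auto simp: arr_def bij_betw_def inj_on_def)

lemma ShM_surj:
  assumes "arr g (Sh C X) (Sh C Y)" "X \<in> Obj C" "Y \<in> Obj C"
  obtains f where "arr f X Y" "ShM C f = g"
proof -
  have "g \<in> ShM C ` arrows C X Y"
    using assms ShM_fully_faithful[of X Y] by (simp add: arr_def bij_betw_def)
  then show ?thesis using that assms by (auto simp: arr_def)
qed

lemma zero_object_Sh: "zero_object C N \<Longrightarrow> zero_object C (Sh C N)"
  by (metis ShM_Ident ShM_zero Sh_closed zero_object_iff)

lemma essentially_surjectiveE:
  assumes "Y \<in> Obj C"
  obtains X e e' where "X \<in> Obj C" "iso_arrow C (Sh C X) Y e" "arr e (Sh C X) Y"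
    "arr e' Y (Sh C X)" "e' \<cdot> e = Ident C (Sh C X)" "e \<cdot> e' = Ident C Y"
    "iso_arrow C Y (Sh C X) e'"
proof -
  obtain X e where X: "X \<in> Obj C" "iso_arrow C (Sh C X) Y e"
    using Sh_essentially_surjective[OF assms] by blast
  obtain e' where "arr e (Sh C X) Y" "arr e' Y (Sh C X)" "e' \<cdot> e = Ident C (Sh C X)"
    "e \<cdot> e' = Ident C Y" "iso_arrow C Y (Sh C X) e'"
    by (rule iso_arrowE[OF X(2) Sh_closed[OF X(1)] assms])
  then show ?thesis using that X by blast
qed

text \<open>An equivalence preserves colimits. Concretely, a target \<open>W\<close> is replaced by
  an isomorphic object \<open>Sh C V\<close>, and full faithfulness moves the problem back to
  morphisms into \<open>V\<close>.\<close>

lemma coproduct_Sh: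
  assumes Z: "is_coproduct C I X Z \<iota>"
  shows "is_coproduct C I (\<lambda>k. Sh C (X k)) (Sh C Z) (\<lambda>k. ShM C (\<iota> k))"
proof (rule coproductI)
  note \<iota> = coproductD[OF Z]
  show "Sh C Z \<in> Obj C" using \<iota>(1) Sh_closed by blast
  show "arr (ShM C (\<iota> k)) (Sh C (X k)) (Sh C Z)" if "k \<in> I" for k
    using arr_ShM[OF \<iota>(2)[OF that]] .
next
  note \<iota> = coproductD[OF Z]
  fix W \<phi> assume W: "W \<in> Obj C" and \<phi>: "\<And>k. k \<in> I \<Longrightarrow> arr (\<phi> k) (Sh C (X k)) W"
  obtain V e e' where V: "V \<in> Obj C" "arr e (Sh C V) W" "arr e' W (Sh C V)"
    "e' \<cdot> e = Ident C (Sh C V)" "e \<cdot> e' = Ident C W"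
    by (rule essentially_surjectiveE[OF W])
  have "\<exists>\<psi>. arr \<psi> (X k) V \<and> ShM C \<psi> = e' \<cdot> \<phi> k" if "k \<in> I" for k
    by (rule ShM_surj[OF arr_Comp[OF \<phi>[OF that] V(3)] arr_dom[OF \<iota>(2)[OF that]] V(1)]) blast
  then obtain \<psi> where \<psi>: "arr (\<psi> k) (X k) V" "ShM C (\<psi> k) = e' \<cdot> \<phi> k" if "k \<in> I" for k
    by metis
  obtain u where u: "arr u Z V" "\<forall>k\<in>I. u \<cdot> \<iota> k = \<psi> k"
    by (rule coproduct_lift[OF Z V(1) \<psi>(1)])
  have "(e \<cdot> ShM C u) \<cdot> ShM C (\<iota> k) = \<phi> k" if k: "k \<in> I" for k
  proof -
    have "(e \<cdot> ShM C u) \<cdot> ShM C (\<iota> k) = e \<cdot> (e' \<cdot> \<phi> k)"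
      using Comp_assoc'[OF arr_ShM[OF \<iota>(2)[OF k]] arr_ShM[OF u(1)] V(2)]
        ShM_Comp'[OF \<iota>(2)[OF k] u(1)] u(2) \<psi>(2)[OF k] k by simp
    also have "\<dots> = \<phi> k" by (rule Comp_cancel_left[OF \<phi>[OF k] V(3,2,5)])
    finally show ?thesis .
  qed
  then show "\<exists>u. arr u (Sh C Z) W \<and> (\<forall>k\<in>I. u \<cdot> ShM C (\<iota> k) = \<phi> k)"
    using arr_Comp[OF arr_ShM[OF u(1)] V(2)] by blast
next
  note \<iota> = coproductD[OF Z]
  fix W u assume u: "arr u (Sh C Z) W"
    and u0: "\<And>k. k \<in> I \<Longrightarrow> u \<cdot> ShM C (\<iota> k) = zero_arrow C (Sh C (X k)) W"
  note W = arr_cod[OF u]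
  obtain V e e' where V: "V \<in> Obj C" "arr e (Sh C V) W" "arr e' W (Sh C V)"
    "e' \<cdot> e = Ident C (Sh C V)" "e \<cdot> e' = Ident C W"
    by (rule essentially_surjectiveE[OF W])
  obtain v where v: "arr v Z V" "ShM C v = e' \<cdot> u"
    by (rule ShM_surj[OF arr_Comp[OF u V(3)] \<iota>(1) V(1)])
  have "v = zero_arrow C Z V"
  proof (rule coproduct_eqI[OF Z v(1) arr_zero[OF \<iota>(1) V(1)]])
    fix k assume k: "k \<in> I"
    have Xk: "X k \<in> Obj C" using arr_dom[OF \<iota>(2)[OF k]] .
    have "ShM C (v \<cdot> \<iota> k) = e' \<cdot> (u \<cdot> ShM C (\<iota> k))"
      using ShM_Comp'[OF \<iota>(2)[OF k] v(1)] v(2) Comp_assoc'[OF arr_ShM[OF \<iota>(2)[OF k]] u V(3)]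
      by simp
    also have "\<dots> = ShM C (zero_arrow C (X k) V)"
      using u0[OF k] Comp_zero_right[OF V(3) Sh_closed[OF Xk]] ShM_zero[OF Xk V(1)] by simp
    finally have "v \<cdot> \<iota> k = zero_arrow C (X k) V"
      by (rule ShM_inj[OF arr_Comp[OF \<iota>(2)[OF k] v(1)] arr_zero[OF Xk V(1)]])
    then show "v \<cdot> \<iota> k = zero_arrow C Z V \<cdot> \<iota> k"
      using Comp_zero_left[OF \<iota>(2)[OF k] V(1)] by simp
  qed
  then have "e' \<cdot> u = zero_arrow C (Sh C Z) (Sh C V)"
    using v(2) ShM_zero[OF \<iota>(1) V(1)] by simp
  then show "u = zero_arrow C (Sh C Z) W"
    using Comp_cancel_left[OF u V(3,2,5)] Comp_zero_right[OF V(2) Sh_closed[OF \<iota>(1)]] by simp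
qed

end

section \<open>Distinguished triangles\<close>

context triangulated_category
begin

lemma Dist_arr:
  assumes "Dist C X Y Z f g h"
  shows "arr f X Y" "arr g Y Z" "arr h Z (Sh C X)"
  using Dist_triangle[OF assms] by (simp_all add: arr_def Sh_closed)

lemma Dist_Obj:
  assumes "Dist C X Y Z f g h"
  shows "X \<in> Obj C" "Y \<in> Obj C" "Z \<in> Obj C"
  using Dist_triangle[OF assms] by simp_all

lemma Dist_completeE:
  assumes "arr f X Y"
  obtains Z g h where "Dist C X Y Z f g h"
  using Dist_complete assms unfolding arr_def by blast

lemma Dist_rotateI:
  assumes "Dist C X Y Z f g h"
  shows "Dist C Y Z (Sh C X) g h (inv\<^bsub>Mor C (Sh C X) (Sh C Y)\<^esub> (ShM C f))"
  using Dist_rotate Dist_triangle[OF assms] assms by blast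

lemma Dist_rotateD:
  assumes "Dist C Y Z (Sh C X) g h (inv\<^bsub>Mor C (Sh C X) (Sh C Y)\<^esub> (ShM C f))" "arr f X Y"
  shows "Dist C X Y Z f g h"
  using Dist_rotate[of X Y Z f g h] Dist_triangle[OF assms(1)] assms by (simp add: arr_def)

text \<open>The last arrow of a rotated triangle has to be a negative shift; full faithfulness
  supplies the \<open>f\<close> with \<open>- f[1] = k\<close>.\<close>

lemma Dist_unrotate:
  assumes "Dist C Y Z (Sh C X) g h k" "X \<in> Obj C"
  obtains f where "Dist C X Y Z f g h"
proof -
  note Y = Dist_Obj(1)[OF assms(1)]
  note k = Dist_arr(3)[OF assms(1)]
  obtain f where f: "arr f X Y" "ShM C f = inv\<^bsub>Mor C (Sh C X) (Sh C Y)\<^esub> k"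
    by (rule ShM_surj[OF arr_inv[OF k] assms(2) Y])
  have "Dist C X Y Z f g h"
    by (rule Dist_rotateD) (use assms f inv_inv_arr[OF k] in simp_all)
  then show ?thesis by (rule that)
qed

text \<open>Three rotations shift a triangle up to signs. The arrows are left unspecified because
  membership in a product of classes depends on the vertices only.\<close>

lemma Dist_ShM:
  assumes "Dist C X Y Z f g h"
  obtains f' g' h' where "Dist C (Sh C X) (Sh C Y) (Sh C Z) f' g' h'"
  using Dist_rotateI[OF Dist_rotateI[OF Dist_rotateI[OF assms]]] by (rule that)

text \<open>The three rotations are undone one at a time; each needs the current third vertex to be
  a literal shift.\<close>

lemma Dist_unshift:
  assumes D: "Dist C (Sh C X) (Sh C Y) (Sh C Z) f g h"
    and X: "X \<in> Obj C" and Y: "Y \<in> Obj C" and Z: "Z \<in> Obj C"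
  obtains f' g' h' where "Dist C X Y Z f' g' h'"
proof -
  obtain h' where 1: "Dist C Z (Sh C X) (Sh C Y) h' f g" by (rule Dist_unrotate[OF D Z])
  obtain g' where 2: "Dist C Y Z (Sh C X) g' h' f" by (rule Dist_unrotate[OF 1 Y])
  obtain f' where "Dist C X Y Z f' g' h'" by (rule Dist_unrotate[OF 2 X])
  then show ?thesis by (rule that)
qed

lemma Dist_iso':
  assumes D: "Dist C X Y Z f g h"
    and a: "iso_arrow C X X' a" "X' \<in> Obj C"
    and b: "iso_arrow C Y Y' b" "Y' \<in> Obj C"
    and c: "iso_arrow C Z Z' c" "Z' \<in> Obj C"
  obtains f' g' h' where "Dist C X' Y' Z' f' g' h'"
proof -
  note O = Dist_Obj[OF D]
  note A = Dist_arr[OF D]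
  obtain a' where a': "arr a X X'" "arr a' X' X" "a' \<cdot> a = Ident C X" "a \<cdot> a' = Ident C X'"
    by (rule iso_arrowE[OF a(1) O(1) a(2)])
  obtain b' where b': "arr b Y Y'" "arr b' Y' Y" "b' \<cdot> b = Ident C Y" "b \<cdot> b' = Ident C Y'"
    by (rule iso_arrowE[OF b(1) O(2) b(2)])
  obtain c' where c': "arr c Z Z'" "arr c' Z' Z" "c' \<cdot> c = Ident C Z" "c \<cdot> c' = Ident C Z'"
    by (rule iso_arrowE[OF c(1) O(3) c(2)])
  note f' = arr_Comp[OF a'(2) arr_Comp[OF A(1) b'(1)]]
  note g' = arr_Comp[OF b'(2) arr_Comp[OF A(2) c'(1)]]
  note h' = arr_Comp[OF c'(2) arr_Comp[OF A(3) arr_ShM[OF a'(1)]]]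
  have "Dist C X' Y' Z' ((b \<cdot> f) \<cdot> a') ((c \<cdot> g) \<cdot> b') ((ShM C a \<cdot> h) \<cdot> c')"
  proof (rule Dist_iso[OF D a(2) b(2) c(2) _ _ _ a(1) b(1) c(1)])
    show "b \<cdot> f = ((b \<cdot> f) \<cdot> a') \<cdot> a"
      using Comp_assoc'[OF a'(1,2) arr_Comp[OF A(1) b'(1)]] a'(3)
        Comp_Ident_right'[OF arr_Comp[OF A(1) b'(1)]] by simp
    show "c \<cdot> g = ((c \<cdot> g) \<cdot> b') \<cdot> b"
      using Comp_assoc'[OF b'(1,2) arr_Comp[OF A(2) c'(1)]] b'(3)
        Comp_Ident_right'[OF arr_Comp[OF A(2) c'(1)]] by simp
    show "ShM C a \<cdot> h = ((ShM C a \<cdot> h) \<cdot> c') \<cdot> c"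
      using Comp_assoc'[OF c'(1,2) arr_Comp[OF A(3) arr_ShM[OF a'(1)]]] c'(3)
        Comp_Ident_right'[OF arr_Comp[OF A(3) arr_ShM[OF a'(1)]]] by simp
  qed (use f' g' h' in \<open>simp_all add: arr_def\<close>)
  then show ?thesis by (rule that)
qed

section \<open>Exactness of the morphism functors\<close>

text \<open>The pair of the identity of \<open>X\<close> and \<open>f\<close> extends to a morphism
  from the triangle \<open>X \<rightarrow> X \<rightarrow> 0\<close>, so \<open>g \<cdot> f\<close>
  factors through a zero object.\<close>

lemma Dist_comp_zero:
  assumes D: "Dist C X Y Z f g h"
  shows "g \<cdot> f = zero_arrow C X Z"
proof -
  note O = Dist_Obj[OF D]
  note A = Dist_arr[OF D]
  obtain N where N: "zero_object C N" using zero_object_exists by blast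
  note NO = zero_object_Obj[OF N]
  obtain c where c: "c \<in> arrows C N Z" "c \<cdot> zero_arrow C X N = g \<cdot> f"
    using Dist_morphism[OF Dist_Ident[OF O(1) N] D, of "Ident C X" f]
      arr_Ident[OF O(1)] A(1) by (auto simp: arr_def)
  then have "arr c N Z" using O NO by (simp add: arr_def)
  then show ?thesis using c(2) Comp_zero_right[OF _ O(1)] by metis
qed

lemma Dist_Ident':
  assumes N: "zero_object C N" and X: "X \<in> Obj C"
  shows "Dist C N X X (zero_arrow C N X) (Ident C X) (zero_arrow C X (Sh C N))"
proof -
  note NO = zero_object_Obj[OF N]
  show ?thesis
  proof (rule Dist_rotateD)
    show "Dist C X X (Sh C N) (Ident C X) (zero_arrow C X (Sh C N))
        (inv\<^bsub>Mor C (Sh C N) (Sh C X)\<^esub> (ShM C (zero_arrow C N X)))"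
      using Dist_Ident[OF X zero_object_Sh[OF N]]
      by (simp add: ShM_zero[OF NO X] inv_zero_arrow Sh_closed NO X)
  qed (rule arr_zero[OF NO X])
qed

text \<open>Exactness of the morphisms into \<open>W\<close>, obtained from a morphism to the
  triangle \<open>0 \<rightarrow> W \<rightarrow> W\<close>.\<close>

lemma Dist_factor_out:
  assumes D: "Dist C X Y Z f g h" and y: "arr y Y W" and 0: "y \<cdot> f = zero_arrow C X W"
  obtains u where "arr u Z W" "u \<cdot> g = y"
proof -
  note O = Dist_Obj[OF D]
  note A = Dist_arr[OF D]
  note W = arr_cod[OF y]
  obtain N where N: "zero_object C N" using zero_object_exists by blast
  note NO = zero_object_Obj[OF N]
  have "y \<cdot> f = zero_arrow C N W \<cdot> zero_arrow C X N"
    using 0 Comp_zero_left[OF arr_zero[OF O(1) NO] W] by simp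
  then obtain u where u: "u \<in> arrows C Z W" "u \<cdot> g = Ident C W \<cdot> y"
    using Dist_morphism[OF D Dist_Ident'[OF N W], of "zero_arrow C X N" y]
      arr_zero[OF O(1) NO] y by (auto simp: arr_def)
  then show ?thesis using that[of u] O W Comp_Ident_left'[OF y] by (simp add: arr_def)
qed

text \<open>Exactness of the morphisms out of \<open>W\<close>. The axiom on morphisms of triangles
  fills in third arrows, whereas here the first one is sought; so both triangles are rotated and the
  resulting \<open>c\<close> is desuspended.\<close>

lemma Dist_factor_in:
  assumes D: "Dist C X Y Z f g h" and y: "arr y W Y" and 0: "g \<cdot> y = zero_arrow C W Z"
  obtains x where "arr x W X" "f \<cdot> x = y"
proof -
  note O = Dist_Obj[OF D]
  note A = Dist_arr[OF D]
  note W = arr_dom[OF y]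
  note y' = arr_ShM[OF y]
  note f' = arr_ShM[OF A(1)]
  note i' = arr_Ident[OF Sh_closed[OF W]]
  obtain N where N: "zero_object C N" using zero_object_exists by blast
  note NO = zero_object_Obj[OF N]
  have "zero_arrow C N Z \<cdot> zero_arrow C W N = g \<cdot> y"
    using 0 Comp_zero_left[OF arr_zero[OF W NO] O(3)] by simp
  then obtain c where c: "c \<in> arrows C (Sh C W) (Sh C X)"
    "ShM C y \<cdot> inv\<^bsub>Mor C (Sh C W) (Sh C W)\<^esub> (ShM C (Ident C W)) =
      inv\<^bsub>Mor C (Sh C X) (Sh C Y)\<^esub> (ShM C f) \<cdot> c"
    using Dist_morphism[OF Dist_rotateI[OF Dist_Ident[OF W N]] Dist_rotateI[OF D],
        of y "zero_arrow C N Z"]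
      arr_zero[OF NO O(3)] y by (auto simp: arr_def)
  have ac: "arr c (Sh C W) (Sh C X)" using c W O by (simp add: arr_def Sh_closed)
  obtain x where x: "arr x W X" "ShM C x = c" by (rule ShM_surj[OF ac W O(1)])
  \<comment> \<open>Rotation puts a sign on both sides; after moving it outside the compositions it
    cancels.\<close>
  have "inv\<^bsub>Mor C (Sh C W) (Sh C Y)\<^esub> (ShM C y) = inv\<^bsub>Mor C (Sh C W) (Sh C Y)\<^esub> (ShM C f \<cdot> c)"
    using c(2) ShM_Ident[OF W] Comp_inv_right[OF i' y'] Comp_Ident_right'[OF y']
      Comp_inv_left[OF ac f'] by simp
  then have "ShM C y = ShM C f \<cdot> c"
    using inv_inv_arr[OF y'] inv_inv_arr[OF arr_Comp[OF ac f']] by metis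
  then have "ShM C y = ShM C (f \<cdot> x)" using ShM_Comp'[OF x(1) A(1)] x(2) by simp
  then have "f \<cdot> x = y" using ShM_inj[OF y arr_Comp[OF x(1) A(1)]] by simp
  then show ?thesis using that x by blast
qed

text \<open>Exactness two rotations further on, where the arrow is \<open>- f[1]\<close>; the sign
  is absorbed into \<open>s\<close>.\<close>

lemma Dist_factor_out_Sh:
  assumes D: "Dist C X Y Z f g h" and t: "arr t (Sh C X) W" and 0: "t \<cdot> h = zero_arrow C Z W"
  obtains s where "arr s (Sh C Y) W" "s \<cdot> ShM C f = t"
proof -
  note f' = arr_ShM[OF Dist_arr(1)[OF D]]
  obtain s where s: "arr s (Sh C Y) W" "s \<cdot> inv\<^bsub>Mor C (Sh C X) (Sh C Y)\<^esub> (ShM C f) = t"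
    by (rule Dist_factor_out[OF Dist_rotateI[OF Dist_rotateI[OF D]] _ 0, OF t])
  have "inv\<^bsub>Mor C (Sh C Y) W\<^esub> s \<cdot> ShM C f = t"
    using Comp_inv_left[OF f' s(1)] Comp_inv_right[OF f' s(1)] s(2) by simp
  then show ?thesis using that arr_inv[OF s(1)] by blast
qed

lemma Dist_ShM_comp_zero:
  assumes D: "Dist C X Y Z f g h"
  shows "ShM C f \<cdot> h = zero_arrow C Z (Sh C Y)"
proof -
  note A = Dist_arr[OF D] and O = Dist_Obj[OF D]
  note f' = arr_ShM[OF A(1)]
  have "inv\<^bsub>Mor C Z (Sh C Y)\<^esub> (ShM C f \<cdot> h) = zero_arrow C Z (Sh C Y)"
    using Dist_comp_zero[OF Dist_rotateI[OF Dist_rotateI[OF D]]] Comp_inv_left[OF A(3) f'] by simp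
  then show ?thesis
    using inv_inv_arr[OF arr_Comp[OF A(3) f']] inv_zero_arrow[OF O(3) Sh_closed[OF O(2)]] by metis
qed

text \<open>
  The proof is the diagram chase of the five lemma for the long exact sequence of morphisms
  from the triangle on the coproducts to \<open>W\<close> and the product of the sequences of the given
  triangles.
\<close>

lemma coproduct_of_cones:
  assumes D: "\<And>k. k \<in> I \<Longrightarrow> Dist C (X k) (Y k) (Z k) (f k) (g k) (h k)"
    and cX: "is_coproduct C I X X' \<iota>" and cY: "is_coproduct C I Y Y' \<eta>"
    and D': "Dist C X' Y' Z' f' g' h'"
    and comm: "\<And>k. k \<in> I \<Longrightarrow> f' \<cdot> \<iota> k = \<eta> k \<cdot> f k"
  shows "\<exists>\<zeta>. is_coproduct C I Z Z' \<zeta>"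
proof -
  note \<iota> = coproductD[OF cX] and \<eta> = coproductD[OF cY]
  note cX1 = coproduct_Sh[OF cX] and cY1 = coproduct_Sh[OF cY]
  note A' = Dist_arr[OF D'] and O' = Dist_Obj[OF D']
  have "\<exists>c. arr c (Z k) Z' \<and> c \<cdot> g k = g' \<cdot> \<eta> k \<and> ShM C (\<iota> k) \<cdot> h k = h' \<cdot> c" if k: "k \<in> I" for k
    using Dist_morphism[OF D[OF k] D', of "\<iota> k" "\<eta> k"] comm[OF k] \<iota>(2)[OF k] \<eta>(2)[OF k]
      Dist_Obj(3)[OF D[OF k]] O' by (auto simp: arr_def)
  then obtain \<zeta> where \<zeta>: "arr (\<zeta> k) (Z k) Z'" "\<zeta> k \<cdot> g k = g' \<cdot> \<eta> k" "ShM C (\<iota> k) \<cdot> h k = h' \<cdot> \<zeta> k"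
    if "k \<in> I" for k by metis
  have "is_coproduct C I Z Z' \<zeta>"
  proof (rule coproductI)
    show "Z' \<in> Obj C" by fact
    show "arr (\<zeta> k) (Z k) Z'" if "k \<in> I" for k using \<zeta>(1)[OF that] .
  next
    fix W \<phi> assume W: "W \<in> Obj C" and \<phi>: "\<And>k. k \<in> I \<Longrightarrow> arr (\<phi> k) (Z k) W"
    have "arr (\<phi> k \<cdot> g k) (Y k) W" if "k \<in> I" for k
      using arr_Comp[OF Dist_arr(2)[OF D[OF that]] \<phi>[OF that]] .
    then obtain y where y: "arr y Y' W" "\<forall>k\<in>I. y \<cdot> \<eta> k = \<phi> k \<cdot> g k"
      by (rule coproduct_lift[OF cY W])
    have "y \<cdot> f' = zero_arrow C X' W"
    proof (rule coproduct_eqI[OF cX arr_Comp[OF A'(1) y(1)] arr_zero[OF O'(1) W]])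
      fix k assume k: "k \<in> I"
      note Ak = Dist_arr[OF D[OF k]]
      have "(y \<cdot> f') \<cdot> \<iota> k = (y \<cdot> \<eta> k) \<cdot> f k"
        using Comp_assoc'[OF \<iota>(2)[OF k] A'(1) y(1)] Comp_assoc'[OF Ak(1) \<eta>(2)[OF k] y(1)] comm[OF k]
        by simp
      also have "\<dots> = \<phi> k \<cdot> (g k \<cdot> f k)"
        using y(2) k Comp_assoc'[OF Ak(1,2) \<phi>[OF k]] by simp
      also have "\<dots> = zero_arrow C (X k) W"
        using Dist_comp_zero[OF D[OF k]] Comp_zero_right[OF \<phi>[OF k] arr_dom[OF Ak(1)]] by simp
      finally show "(y \<cdot> f') \<cdot> \<iota> k = zero_arrow C X' W \<cdot> \<iota> k"
        using Comp_zero_left[OF \<iota>(2)[OF k] W] by simp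
    qed
    then obtain u where u: "arr u Z' W" "u \<cdot> g' = y"
      by (rule Dist_factor_out[OF D' y(1)])
    \<comment> \<open>So far \<open>u\<close> is correct only after precomposition with
      \<open>g k\<close>. The error \<open>d k\<close> vanishes there and hence comes from
      \<open>X k[1]\<close>. The errors assemble over the coproduct \<open>X'[1]\<close> to
      \<open>t'\<close>, and subtracting \<open>t' \<cdot> h'\<close> corrects
      \<open>u\<close>.\<close>
    define d where "d k = diff (Z k) W (u \<cdot> \<zeta> k) (\<phi> k)" for k
    have d: "arr (d k) (Z k) W" if "k \<in> I" for k
      unfolding d_def using arr_diff[OF arr_Comp[OF \<zeta>(1)[OF that] u(1)] \<phi>[OF that]] .
    have "\<exists>t. arr t (Sh C (X k)) W \<and> t \<cdot> h k = d k" if k: "k \<in> I" for k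
    proof -
      note Ak = Dist_arr[OF D[OF k]]
      have "d k \<cdot> g k = diff (Y k) W ((u \<cdot> \<zeta> k) \<cdot> g k) (\<phi> k \<cdot> g k)"
        unfolding d_def by (rule Comp_diff_left[OF Ak(2) arr_Comp[OF \<zeta>(1)[OF k] u(1)] \<phi>[OF k]])
      moreover have "(u \<cdot> \<zeta> k) \<cdot> g k = \<phi> k \<cdot> g k"
        using Comp_assoc'[OF Ak(2) \<zeta>(1)[OF k] u(1)] \<zeta>(2)[OF k]
          Comp_assoc'[OF \<eta>(2)[OF k] A'(2) u(1)] u(2) y(2) k by simp
      ultimately have "d k \<cdot> g k = zero_arrow C (Y k) W"
        using diff_self[OF arr_Comp[OF Ak(2) \<phi>[OF k]]] by simp
      then show ?thesis
        by (rule Dist_factor_out[OF Dist_rotateI[OF D[OF k]] d[OF k]]) blast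
    qed
    then obtain t where t: "arr (t k) (Sh C (X k)) W" "t k \<cdot> h k = d k" if "k \<in> I" for k
      by metis
    obtain t' where t': "arr t' (Sh C X') W" "\<forall>k\<in>I. t' \<cdot> ShM C (\<iota> k) = t k"
      by (rule coproduct_lift[OF cX1 W t(1)])
    have th: "arr (t' \<cdot> h') Z' W" using arr_Comp[OF A'(3) t'(1)] .
    have "diff Z' W u (t' \<cdot> h') \<cdot> \<zeta> k = \<phi> k" if k: "k \<in> I" for k
    proof -
      note Ak = Dist_arr[OF D[OF k]]
      have "(t' \<cdot> h') \<cdot> \<zeta> k = t' \<cdot> (ShM C (\<iota> k) \<cdot> h k)"
        using Comp_assoc'[OF \<zeta>(1)[OF k] A'(3) t'(1)] \<zeta>(3)[OF k] by simp
      also have "\<dots> = d k"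
        using Comp_assoc'[OF Ak(3) arr_ShM[OF \<iota>(2)[OF k]] t'(1)] t'(2) t(2)[OF k] k by simp
      finally have "diff Z' W u (t' \<cdot> h') \<cdot> \<zeta> k = diff (Z k) W (u \<cdot> \<zeta> k) (d k)"
        using Comp_diff_left[OF \<zeta>(1)[OF k] u(1) th] by simp
      then show ?thesis
        unfolding d_def using diff_diff_self[OF arr_Comp[OF \<zeta>(1)[OF k] u(1)] \<phi>[OF k]] by simp
    qed
    then show "\<exists>u. arr u Z' W \<and> (\<forall>k\<in>I. u \<cdot> \<zeta> k = \<phi> k)"
      using arr_diff[OF u(1) th] by blast
  next
    fix W u assume u: "arr u Z' W" and u0: "\<And>k. k \<in> I \<Longrightarrow> u \<cdot> \<zeta> k = zero_arrow C (Z k) W"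
    note W = arr_cod[OF u]
    have "u \<cdot> g' = zero_arrow C Y' W"
    proof (rule coproduct_eqI[OF cY arr_Comp[OF A'(2) u] arr_zero[OF O'(2) W]])
      fix k assume k: "k \<in> I"
      note Ak = Dist_arr[OF D[OF k]]
      have "(u \<cdot> g') \<cdot> \<eta> k = (u \<cdot> \<zeta> k) \<cdot> g k"
        using Comp_assoc'[OF \<eta>(2)[OF k] A'(2) u] Comp_assoc'[OF Ak(2) \<zeta>(1)[OF k] u] \<zeta>(2)[OF k]
        by simp
      then show "(u \<cdot> g') \<cdot> \<eta> k = zero_arrow C Y' W \<cdot> \<eta> k"
        using u0[OF k] Comp_zero_left[OF Ak(2) W] Comp_zero_left[OF \<eta>(2)[OF k] W] by simp
    qed
    then obtain t where t: "arr t (Sh C X') W" "t \<cdot> h' = u"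
      by (rule Dist_factor_out[OF Dist_rotateI[OF D'] u])
    have "\<exists>s. arr s (Sh C (Y k)) W \<and> s \<cdot> ShM C (f k) = t \<cdot> ShM C (\<iota> k)" if k: "k \<in> I" for k
    proof -
      note Ak = Dist_arr[OF D[OF k]] and \<iota>k = arr_ShM[OF \<iota>(2)[OF k]]
      have "(t \<cdot> ShM C (\<iota> k)) \<cdot> h k = (t \<cdot> h') \<cdot> \<zeta> k"
        using Comp_assoc'[OF Ak(3) \<iota>k t(1)] Comp_assoc'[OF \<zeta>(1)[OF k] A'(3) t(1)] \<zeta>(3)[OF k]
        by simp
      then have "(t \<cdot> ShM C (\<iota> k)) \<cdot> h k = zero_arrow C (Z k) W"
        using t(2) u0[OF k] by simp
      then show ?thesis
        by (rule Dist_factor_out_Sh[OF D[OF k] arr_Comp[OF \<iota>k t(1)]]) blast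
    qed
    then obtain s where s: "arr (s k) (Sh C (Y k)) W" "s k \<cdot> ShM C (f k) = t \<cdot> ShM C (\<iota> k)"
      if "k \<in> I" for k by metis
    obtain s' where s': "arr s' (Sh C Y') W" "\<forall>k\<in>I. s' \<cdot> ShM C (\<eta> k) = s k"
      by (rule coproduct_lift[OF cY1 W s(1)])
    \<comment> \<open>The lift \<open>t\<close> of \<open>u\<close> need not vanish, being
      determined only up to morphisms that factor through \<open>f'[1]\<close>. It suffices that
      \<open>t\<close> itself factors in this way, since
      \<open>f'[1] \<cdot> h' = 0\<close>.\<close>
    have "t = s' \<cdot> ShM C f'"
    proof (rule coproduct_eqI[OF cX1 t(1) arr_Comp[OF arr_ShM[OF A'(1)] s'(1)]])
      fix k assume k: "k \<in> I"
      note Ak = Dist_arr[OF D[OF k]]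
      have "(s' \<cdot> ShM C f') \<cdot> ShM C (\<iota> k) = s' \<cdot> ShM C (\<eta> k \<cdot> f k)"
        using Comp_assoc'[OF arr_ShM[OF \<iota>(2)[OF k]] arr_ShM[OF A'(1)] s'(1)]
          ShM_Comp'[OF \<iota>(2)[OF k] A'(1)] comm[OF k] by simp
      also have "\<dots> = s k \<cdot> ShM C (f k)"
        using Comp_assoc'[OF arr_ShM[OF Ak(1)] arr_ShM[OF \<eta>(2)[OF k]] s'(1)]
          ShM_Comp'[OF Ak(1) \<eta>(2)[OF k]] s'(2) k by simp
      finally show "t \<cdot> ShM C (\<iota> k) = (s' \<cdot> ShM C f') \<cdot> ShM C (\<iota> k)" using s(2)[OF k] by simp
    qed
    then have "u = s' \<cdot> (ShM C f' \<cdot> h')"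
      using t(2) Comp_assoc'[OF A'(3) arr_ShM[OF A'(1)] s'(1)] by simp
    then show "u = zero_arrow C Z' W"
      using Dist_ShM_comp_zero[OF D'] Comp_zero_right[OF s'(1) O'(3)] by simp
  qed
  then show ?thesis by blast
qed

section \<open>Split triangles\<close>

text \<open>Since \<open>h = 0\<close>, the identity of \<open>Y\<close> lifts along
  \<open>g\<close> to a section \<open>s\<close>, and \<open>f\<close> is monic. The equations for
  \<open>r\<close> are then checked after composing with \<open>f\<close>.\<close>

lemma Dist_split:
  assumes D: "Dist C X Z Y f g h" and h: "h = zero_arrow C Y (Sh C X)"
  obtains r s where "arr r Z X" "arr s Y Z" "r \<cdot> f = Ident C X" "g \<cdot> s = Ident C Y"
    "r \<cdot> s = zero_arrow C Y X" "f \<cdot> r = diff Z Z (Ident C Z) (s \<cdot> g)"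
proof -
  note O = Dist_Obj[OF D] and A = Dist_arr[OF D]
  note iX = arr_Ident[OF O(1)] and iZ = arr_Ident[OF O(2)] and iY = arr_Ident[OF O(3)]
  have "h \<cdot> Ident C Y = zero_arrow C Y (Sh C X)"
    using h Comp_Ident_right'[OF A(3)] by simp
  then obtain s where s: "arr s Y Z" "g \<cdot> s = Ident C Y"
    by (rule Dist_factor_in[OF Dist_rotateI[OF D] iY])
  \<comment> \<open>The idempotent complementary to \<open>s \<cdot> g\<close>; as \<open>g\<close>
    kills it, it factors through \<open>f\<close>, which yields the retraction
    \<open>r\<close>.\<close>
  define e where "e = diff Z Z (Ident C Z) (s \<cdot> g)"
  have sg: "arr (s \<cdot> g) Z Z" using arr_Comp[OF A(2) s(1)] .
  have e: "arr e Z Z" unfolding e_def using arr_diff[OF iZ sg] .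
  have "g \<cdot> e = zero_arrow C Z Y"
    unfolding e_def
    using Comp_diff_right[OF iZ sg A(2)] Comp_Ident_right'[OF A(2)] Comp_assoc'[OF A(2) s(1) A(2)]
      s(2) Comp_Ident_left'[OF A(2)] diff_self[OF A(2)] by simp
  then obtain r where r: "arr r Z X" "f \<cdot> r = e" by (rule Dist_factor_in[OF D e])
  \<comment> \<open>The term before \<open>X\<close> in the triangle would be a desuspension of
    \<open>Y\<close>, so the argument runs one shift higher: a morphism killed by
    \<open>f[1]\<close> factors through \<open>h = 0\<close>.\<close>
  have mono: "x = x'" if x: "arr x W X" "arr x' W X" "f \<cdot> x = f \<cdot> x'" for x x' W
  proof -
    note d = arr_diff[OF x(1,2)] and W = arr_dom[OF x(1)]
    have "f \<cdot> diff W X x x' = zero_arrow C W Z"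
      using Comp_diff_right[OF x(1,2) A(1)] x(3) diff_self[OF arr_Comp[OF x(2) A(1)]] by simp
    then have "ShM C f \<cdot> ShM C (diff W X x x') = zero_arrow C (Sh C W) (Sh C Z)"
      using ShM_Comp'[OF d A(1)] ShM_zero[OF W O(2)] by simp
    then have "inv\<^bsub>Mor C (Sh C X) (Sh C Z)\<^esub> (ShM C f) \<cdot> ShM C (diff W X x x') =
        zero_arrow C (Sh C W) (Sh C Z)"
      using Comp_inv_left[OF arr_ShM[OF d] arr_ShM[OF A(1)]]
        inv_zero_arrow[OF Sh_closed[OF W] Sh_closed[OF O(2)]] by simp
    then obtain w where w: "arr w (Sh C W) Y" "h \<cdot> w = ShM C (diff W X x x')"
      by (rule Dist_factor_in[OF Dist_rotateI[OF Dist_rotateI[OF D]] arr_ShM[OF d]])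
    have "ShM C (diff W X x x') = ShM C (zero_arrow C W X)"
      using w(2) h Comp_zero_left[OF w(1) Sh_closed[OF O(1)]] ShM_zero[OF W O(1)] by simp
    then have "diff W X x x' = zero_arrow C W X"
      by (rule ShM_inj[OF d arr_zero[OF W O(1)]])
    then show ?thesis by (rule diff_eq_zeroD[OF x(1,2)])
  qed
  have "r \<cdot> f = Ident C X"
  proof (rule mono[OF arr_Comp[OF A(1) r(1)] iX])
    have "f \<cdot> (r \<cdot> f) = e \<cdot> f" using Comp_assoc'[OF A(1) r(1) A(1)] r(2) by simp
    also have "\<dots> = diff X Z f (s \<cdot> (g \<cdot> f))"
      unfolding e_def using Comp_diff_left[OF A(1) iZ sg] Comp_Ident_left'[OF A(1)]
        Comp_assoc'[OF A(1,2) s(1)] by simp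
    also have "\<dots> = f"
      using Dist_comp_zero[OF D] Comp_zero_right[OF s(1) O(1)] diff_zero[OF A(1)] by simp
    finally show "f \<cdot> (r \<cdot> f) = f \<cdot> Ident C X" using Comp_Ident_right'[OF A(1)] by simp
  qed
  moreover have "r \<cdot> s = zero_arrow C Y X"
  proof (rule mono[OF arr_Comp[OF s(1) r(1)] arr_zero[OF O(3,1)]])
    have "f \<cdot> (r \<cdot> s) = e \<cdot> s" using Comp_assoc'[OF s(1) r(1) A(1)] r(2) by simp
    also have "\<dots> = zero_arrow C Y Z"
      unfolding e_def using Comp_diff_left[OF s(1) iZ sg] Comp_Ident_left'[OF s(1)]
        Comp_assoc'[OF s(1) A(2) s(1)] s(2) Comp_Ident_right'[OF s(1)] diff_self[OF s(1)] by simp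
    finally show "f \<cdot> (r \<cdot> s) = f \<cdot> zero_arrow C Y X" using Comp_zero_right[OF A(1) O(3)] by simp
  qed
  ultimately show ?thesis using that[OF r(1) s(1)] s(2) r(2) e_def by blast
qed

text \<open>The section \<open>s\<close> is completed to a triangle, and its cone \<open>V\<close>
  is identified with \<open>X\<close>: the retraction \<open>r\<close> induces \<open>c\<close> from
  \<open>V\<close> to \<open>X\<close>, with inverse \<open>i \<cdot> f\<close>.\<close>

lemma Dist_split_swap:
  assumes D: "Dist C X Z Y f g h" and h: "h = zero_arrow C Y (Sh C X)"
  obtains s r h' where "Dist C Y Z X s r h'"
proof -
  note O = Dist_Obj[OF D] and A = Dist_arr[OF D]
  note iZ = arr_Ident[OF O(2)]
  obtain r s where r: "arr r Z X" and s: "arr s Y Z" and rs: "r \<cdot> f = Ident C X" "g \<cdot> s = Ident C Y"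
    "r \<cdot> s = zero_arrow C Y X" "f \<cdot> r = diff Z Z (Ident C Z) (s \<cdot> g)"
    by (rule Dist_split[OF D h])
  obtain V i i' where V: "Dist C Y Z V s i i'" by (rule Dist_completeE[OF s])
  note OV = Dist_Obj(3)[OF V] and AV = Dist_arr[OF V]
  \<comment> \<open>As \<open>g[1]\<close> is a retraction of \<open>s[1]\<close>, the relation
    \<open>s[1] \<cdot> i' = 0\<close> forces \<open>i' = 0\<close>; this makes \<open>i\<close>
    epic.\<close>
  have "i' = zero_arrow C V (Sh C Y)"
    using Comp_cancel_left[OF AV(3) arr_ShM[OF s] arr_ShM[OF A(2)]] ShM_Comp'[OF s A(2)] rs(2)
      ShM_Ident[OF O(3)] Dist_ShM_comp_zero[OF V]
      Comp_zero_right[OF arr_ShM[OF A(2)] OV] by simp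
  have epi: "t = t'" if t: "arr t V W" "arr t' V W" "t \<cdot> i = t' \<cdot> i" for t t' W
  proof -
    note d = arr_diff[OF t(1,2)]
    have "diff V W t t' \<cdot> i = zero_arrow C Z W"
      using Comp_diff_left[OF AV(2) t(1,2)] t(3) diff_self[OF arr_Comp[OF AV(2) t(2)]] by simp
    then obtain w where "arr w (Sh C Y) W" "w \<cdot> i' = diff V W t t'"
      by (rule Dist_factor_out[OF Dist_rotateI[OF V] d])
    then have "diff V W t t' = zero_arrow C V W"
      using \<open>i' = _\<close> Comp_zero_right[OF _ OV] by metis
    then show ?thesis by (rule diff_eq_zeroD[OF t(1,2)])
  qed
  obtain c where c: "arr c V X" "c \<cdot> i = r" by (rule Dist_factor_out[OF V r rs(3)])
  note jf = arr_Comp[OF A(1) AV(2)]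
  have "iso_arrow C V X c"
  proof (rule iso_arrowI[OF c(1) jf])
    show "c \<cdot> (i \<cdot> f) = Ident C X" using Comp_assoc'[OF A(1) AV(2) c(1)] c(2) rs(1) by simp
    show "(i \<cdot> f) \<cdot> c = Ident C V"
    proof (rule epi[OF arr_Comp[OF c(1) jf] arr_Ident[OF OV]])
      have "((i \<cdot> f) \<cdot> c) \<cdot> i = i \<cdot> (f \<cdot> r)"
        using Comp_assoc'[OF AV(2) c(1) jf] c(2) Comp_assoc'[OF r A(1) AV(2)] by simp
      also have "\<dots> = diff Z V i ((i \<cdot> s) \<cdot> g)"
        using rs(4) Comp_diff_right[OF iZ arr_Comp[OF A(2) s] AV(2)] Comp_Ident_right'[OF AV(2)]
          Comp_assoc'[OF A(2) s AV(2)] by simp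
      also have "\<dots> = i"
        using Dist_comp_zero[OF V] Comp_zero_left[OF A(2) OV] diff_zero[OF AV(2)] by simp
      finally show "((i \<cdot> f) \<cdot> c) \<cdot> i = Ident C V \<cdot> i" using Comp_Ident_left'[OF AV(2)] by simp
    qed
  qed
  then show ?thesis
    using Dist_iso'[OF V iso_arrow_Ident[OF O(3)] O(3) iso_arrow_Ident[OF O(2)] O(2) _ O(1)] that
    by blast
qed

text \<open>The injections are \<open>f\<close> and the section \<open>s\<close>. The labels
  \<open>a\<close> and \<open>b\<close> are arbitrary because index sets must live in the type
  underlying \<kappa>.\<close>

lemma Dist_split_coproduct:
  assumes D: "Dist C X Z Y f g h" and h: "h = zero_arrow C Y (Sh C X)" and ab: "a \<noteq> b"
  shows "\<exists>\<iota>. is_coproduct C {a, b} (\<lambda>k. if k = a then X else Y) Z \<iota>"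
proof -
  note O = Dist_Obj[OF D] and A = Dist_arr[OF D]
  note iZ = arr_Ident[OF O(2)]
  obtain r s where r: "arr r Z X" and s: "arr s Y Z" and rs: "r \<cdot> f = Ident C X" "g \<cdot> s = Ident C Y"
    "r \<cdot> s = zero_arrow C Y X" "f \<cdot> r = diff Z Z (Ident C Z) (s \<cdot> g)"
    by (rule Dist_split[OF D h])
  note sg = arr_Comp[OF A(2) s] and fr = arr_Comp[OF r A(1)]
  have sum: "(f \<cdot> r) \<otimes>\<^bsub>Mor C Z Z\<^esub> (s \<cdot> g) = Ident C Z"
    using rs(4) diff_add_cancel[OF iZ sg] by simp
  have "is_coproduct C {a, b} (\<lambda>k. if k = a then X else Y) Z (\<lambda>k. if k = a then f else s)"
  proof (rule coproductI)
    show "Z \<in> Obj C" by fact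
    show "arr (if k = a then f else s) (if k = a then X else Y) Z" for k using A s by simp
  next
    fix W \<phi> assume W: "W \<in> Obj C"
      and \<phi>: "\<And>k. k \<in> {a, b} \<Longrightarrow> arr (\<phi> k) (if k = a then X else Y) W"
    have a: "arr (\<phi> a) X W" and b: "arr (\<phi> b) Y W" using \<phi>[of a] \<phi>[of b] ab by auto
    note ar = arr_Comp[OF r a] and bg = arr_Comp[OF A(2) b]
    \<comment> \<open>The usual formula for biproducts, with \<open>r\<close> and \<open>g\<close>
      as the projections.\<close>
    let ?u = "(\<phi> a \<cdot> r) \<otimes>\<^bsub>Mor C Z W\<^esub> (\<phi> b \<cdot> g)"
    have "?u \<cdot> f = \<phi> a"
      using Comp_add_left'[OF A(1) ar bg] Comp_assoc'[OF A(1) r a] Comp_assoc'[OF A(1,2) b]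
        rs(1) Comp_Ident_right'[OF a] Dist_comp_zero[OF D] Comp_zero_right[OF b O(1)]
        add_zero_right[OF a] by simp
    moreover have "?u \<cdot> s = \<phi> b"
      using Comp_add_left'[OF s ar bg] Comp_assoc'[OF s r a] Comp_assoc'[OF s A(2) b]
        rs(2,3) Comp_Ident_right'[OF b] Comp_zero_right[OF a O(3)]
        add_zero_left[OF b] by simp
    ultimately have "\<forall>k\<in>{a, b}. ?u \<cdot> (if k = a then f else s) = \<phi> k" using ab by auto
    then show "\<exists>u. arr u Z W \<and> (\<forall>k\<in>{a, b}. u \<cdot> (if k = a then f else s) = \<phi> k)"
      using arr_add[OF ar bg] by blast
  next
    fix W u assume u: "arr u Z W" and u0: "\<And>k. k \<in> {a, b} \<Longrightarrow>
      u \<cdot> (if k = a then f else s) = zero_arrow C (if k = a then X else Y) W"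
    note W = arr_cod[OF u]
    have "u \<cdot> f = zero_arrow C X W" "u \<cdot> s = zero_arrow C Y W" using u0[of a] u0[of b] ab by auto
    then have "u \<cdot> (f \<cdot> r) = zero_arrow C Z W" "u \<cdot> (s \<cdot> g) = zero_arrow C Z W"
      using Comp_assoc'[OF r A(1) u] Comp_assoc'[OF A(2) s u] Comp_zero_left[OF r W]
        Comp_zero_left[OF A(2) W] by simp_all
    then have "u \<cdot> Ident C Z = zero_arrow C Z W"
      using Comp_add_right'[OF fr sg u] sum add_zero_left[OF arr_zero[OF O(2) W]] by simp
    then show "u = zero_arrow C Z W" using Comp_Ident_right'[OF u] by simp
  qed
  then show ?thesis by blast
qed

section \<open>Associativity of the extension product\<close>

text \<open>The octahedral axiom for \<open>X \<rightarrow> S \<rightarrow> T\<close>: the cone of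
  the composite is an extension of \<open>Z\<close> by \<open>Y\<close>.\<close>

lemma star_assoc_right: "star C (star C \<X> \<Y>) \<Z> \<subseteq> star C \<X> (star C \<Y> \<Z>)"
proof
  fix T assume "T \<in> star C (star C \<X> \<Y>) \<Z>"
  then obtain X Y Z S f i i' g j j' where *: "X \<in> \<X>" "Y \<in> \<Y>" "Z \<in> \<Z>"
    "Dist C X S Y f i i'" "Dist C S T Z g j j'"
    unfolding star_def by blast
  obtain V k k' where V: "Dist C X T V (g \<cdot> f) k k'"
    by (rule Dist_completeE[OF arr_Comp[OF Dist_arr(1)[OF *(4)] Dist_arr(1)[OF *(5)]]])
  then obtain u v where "Dist C Y V Z u v (ShM C i \<cdot> j')"
    using Dist_octahedron[OF *(4,5) V] by blast
  then have "V \<in> star C \<Y> \<Z>" unfolding star_def using * by blast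
  then show "T \<in> star C \<X> (star C \<Y> \<Z>)" using V *(1) unfolding star_def by blast
qed

text \<open>The octahedral axiom for \<open>T \<rightarrow> S \<rightarrow> Z\<close>, available
  after rotating. The cone \<open>V\<close> of the composite is an extension of \<open>Y[1]\<close>
  by \<open>X[1]\<close>, hence a shifted copy of the intermediate object; essential surjectivity
  supplies a desuspension \<open>W\<close>.\<close>

lemma star_assoc_left: "star C \<X> (star C \<Y> \<Z>) \<subseteq> star C (star C \<X> \<Y>) \<Z>"
proof
  fix T assume "T \<in> star C \<X> (star C \<Y> \<Z>)"
  then obtain X Y Z S f g h f' g' h' where *: "X \<in> \<X>" "Y \<in> \<Y>" "Z \<in> \<Z>"
    "Dist C X T S f g h" "Dist C Y S Z f' g' h'"
    unfolding star_def by blast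
  note D = Dist_rotateI[OF *(4)] and D' = Dist_rotateI[OF *(5)]
  note X = Dist_Obj(1)[OF *(4)] and Y = Dist_Obj(1)[OF *(5)]
    and TZ = Dist_Obj(2)[OF *(4)] Dist_Obj(3)[OF *(5)]
  obtain V k k' where V: "Dist C T Z V (g' \<cdot> g) k k'"
    by (rule Dist_completeE[OF arr_Comp[OF Dist_arr(1)[OF D] Dist_arr(1)[OF D']]])
  obtain u v w where V': "Dist C (Sh C X) V (Sh C Y) u v w"
    using Dist_octahedron[OF D D' V] by blast
  obtain W e where W: "W \<in> Obj C" "iso_arrow C V (Sh C W) e"
    by (rule essentially_surjectiveE[OF Dist_Obj(3)[OF V]])
  note SW = Sh_closed[OF W(1)]
  obtain u' v' w' where "Dist C (Sh C X) (Sh C W) (Sh C Y) u' v' w'"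
    by (rule Dist_iso'[OF V' iso_arrow_Ident _ W(2) SW iso_arrow_Ident])
      (simp_all add: X Y Sh_closed)
  then obtain f'' g'' h'' where "Dist C X W Y f'' g'' h''"
    by (rule Dist_unshift[OF _ X W(1) Y])
  then have "W \<in> star C \<X> \<Y>" unfolding star_def using * by blast
  moreover obtain k1 k2 k3 where "Dist C T Z (Sh C W) k1 k2 k3"
    by (rule Dist_iso'[OF V iso_arrow_Ident _ iso_arrow_Ident _ W(2) SW]) (simp_all add: TZ)
  then obtain f3 where "Dist C W T Z f3 k1 k2"
    by (rule Dist_unrotate[OF _ W(1)])
  ultimately show "T \<in> star C (star C \<X> \<Y>) \<Z>" using *(3) unfolding star_def by blast
qed

end

section \<open>Smallness\<close>

lemma smallness_cardinal_infinite:
  assumes "smallness_cardinal \<kappa>"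
  shows "infinite (Field \<kappa>)"
proof -
  have "natLeq \<le>o \<kappa>" "Card_order \<kappa>"
    using assms ordLess_imp_ordLeq by (auto simp: smallness_cardinal_def)
  then have "natLeq \<le>o |Field \<kappa>|"
    using ordLeq_ordIso_trans ordIso_symmetric card_of_Field_ordIso by blast
  then show ?thesis using infinite_iff_natLeq_ordLeq by blast
qed

lemma small_finite: "\<lbrakk>smallness_cardinal \<kappa>; finite I\<rbrakk> \<Longrightarrow> small \<kappa> I"
  unfolding small_def smallness_cardinal_def finite_iff_ordLess_natLeq
  by (blast intro: ordLess_transitive)

lemma smallness_cardinal_two_elements:
  assumes "smallness_cardinal (\<kappa> :: 'u rel)"
  obtains a b :: 'u where "a \<noteq> b"
proof -
  have "infinite (Field \<kappa>)" by (rule smallness_cardinal_infinite[OF assms])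
  then obtain a where "a \<in> Field \<kappa>" using infinite_imp_nonempty by blast
  moreover have "infinite (Field \<kappa> - {a})" using \<open>infinite (Field \<kappa>)\<close> by simp
  then obtain b where "b \<in> Field \<kappa> - {a}" using infinite_imp_nonempty by blast
  ultimately show ?thesis using that[of a b] by blast
qed

text \<open>Needed to iterate coproducts: index pairs have to be recoded inside the type of
  \<kappa>, where index sets are required to lie.\<close>

lemma small_Sigma_copy:
  fixes \<kappa> :: "'u rel" and J :: "'u \<Rightarrow> 'u set"
  assumes \<kappa>: "smallness_cardinal \<kappa>" and I: "small \<kappa> I" and J: "\<And>k. k \<in> I \<Longrightarrow> small \<kappa> (J k)"
  obtains K :: "'u set" and p where "small \<kappa> K" "bij_betw p K (Sigma I J)"
proof -
  have \<kappa>': "Card_order \<kappa>" "regularCard \<kappa>" using \<kappa> by (simp_all add: smallness_cardinal_def)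
  \<comment> \<open>Regularity enters here: a small union of small sets is small.\<close>
  have "stable \<kappa>" by (rule regularCard_stable[OF \<kappa>'(1) smallness_cardinal_infinite[OF \<kappa>] \<kappa>'(2)])
  then have less: "|Sigma I J| <o \<kappa>"
    using I J unfolding stable_def small_def by blast
  have "|Sigma I J| \<le>o |Field \<kappa>|"
    by (rule ordLeq_ordIso_trans[OF ordLess_imp_ordLeq[OF less]
          ordIso_symmetric[OF card_of_Field_ordIso[OF \<kappa>'(1)]]])
  then obtain q :: "'u \<times> 'u \<Rightarrow> 'u" where q: "inj_on q (Sigma I J)"
    unfolding card_of_ordLeq[symmetric] by blast
  define K where "K = q ` Sigma I J"
  have "bij_betw q (Sigma I J) K" using q by (simp add: K_def bij_betw_def)
  then have p: "bij_betw (inv_into (Sigma I J) q) K (Sigma I J)" by (rule bij_betw_inv_into)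
  have "|K| \<le>o |Sigma I J|" unfolding K_def by (rule card_of_image)
  then have "small \<kappa> K" unfolding small_def by (rule ordLeq_ordLess_trans[OF _ less])
  then show ?thesis using that p by blast
qed

text \<open>A coproduct of coproducts is a coproduct over the disjoint union of the index sets,
  which \<open>K\<close> represents through \<open>p\<close>. Morphisms are assembled first over
  each \<open>J k\<close> and then over \<open>I\<close>.\<close>

lemma (in preadditive_category) coproduct_Sigma:
  assumes T: "is_coproduct C I Z T \<tau>"
    and Z: "\<And>k. k \<in> I \<Longrightarrow> is_coproduct C (J k) (X k) (Z k) (\<iota> k)"
    and p: "bij_betw p K (Sigma I J)"
  shows "is_coproduct C K (\<lambda>m. X (fst (p m)) (snd (p m))) T
    (\<lambda>m. \<tau> (fst (p m)) \<cdot> \<iota> (fst (p m)) (snd (p m)))"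
proof (rule coproductI)
  note \<tau> = coproductD[OF T]
  have pK: "fst (p m) \<in> I" "snd (p m) \<in> J (fst (p m))" if "m \<in> K" for m
    using bij_betwE[OF p] that by (auto simp: Sigma_def)
  show "T \<in> Obj C" by fact
  show "arr (\<tau> (fst (p m)) \<cdot> \<iota> (fst (p m)) (snd (p m))) (X (fst (p m)) (snd (p m))) T"
    if "m \<in> K" for m
    using arr_Comp[OF coproductD(2)[OF Z] \<tau>(2)] pK[OF that] by blast
next
  note \<tau> = coproductD[OF T]
  fix W \<phi> assume W: "W \<in> Obj C" and \<phi>: "\<And>m. m \<in> K \<Longrightarrow> arr (\<phi> m) (X (fst (p m)) (snd (p m))) W"
  have pK: "fst (p m) \<in> I" "snd (p m) \<in> J (fst (p m))" if "m \<in> K" for m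
    using bij_betwE[OF p] that by (auto simp: Sigma_def)
  let ?q = "inv_into K p"
  have q: "?q (k, j) \<in> K" "p (?q (k, j)) = (k, j)" if "k \<in> I" "j \<in> J k" for k j
    using that p by (auto simp: bij_betw_def inv_into_into f_inv_into_f)
  have qp: "?q (p m) = m" if "m \<in> K" for m
    using that p by (simp add: bij_betw_def)
  have "\<exists>v. arr v (Z k) W \<and> (\<forall>j\<in>J k. v \<cdot> \<iota> k j = \<phi> (?q (k, j)))" if k: "k \<in> I" for k
  proof -
    have "arr (\<phi> (?q (k, j))) (X k j) W" if "j \<in> J k" for j
      using \<phi>[OF q(1)[OF k that]] q(2)[OF k that] by simp
    then obtain v where "arr v (Z k) W" "\<forall>j\<in>J k. v \<cdot> \<iota> k j = \<phi> (?q (k, j))"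
      by (rule coproduct_lift[OF Z[OF k] W])
    then show ?thesis by (intro exI conjI)
  qed
  then obtain v where v: "arr (v k) (Z k) W" "\<forall>j\<in>J k. v k \<cdot> \<iota> k j = \<phi> (?q (k, j))" if "k \<in> I" for k
    by metis
  obtain u where u: "arr u T W" "\<forall>k\<in>I. u \<cdot> \<tau> k = v k"
    by (rule coproduct_lift[OF T W v(1)])
  have "u \<cdot> (\<tau> (fst (p m)) \<cdot> \<iota> (fst (p m)) (snd (p m))) = \<phi> m" if m: "m \<in> K" for m
  proof -
    note pm = pK[OF m]
    show ?thesis
      using Comp_assoc'[OF coproductD(2)[OF Z[OF pm(1)] pm(2)] \<tau>(2)[OF pm(1)] u(1)]
        u(2) pm v(2)[OF pm(1)] qp[OF m] by simp
  qed
  then show "\<exists>u. arr u T W \<and> (\<forall>m\<in>K. u \<cdot> (\<tau> (fst (p m)) \<cdot> \<iota> (fst (p m)) (snd (p m))) = \<phi> m)"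
    using u(1) by blast
next
  note \<tau> = coproductD[OF T]
  fix W u assume u: "arr u T W" and u0: "\<And>m. m \<in> K \<Longrightarrow>
    u \<cdot> (\<tau> (fst (p m)) \<cdot> \<iota> (fst (p m)) (snd (p m))) = zero_arrow C (X (fst (p m)) (snd (p m))) W"
  note W = arr_cod[OF u]
  have u1: "u \<cdot> (\<tau> k \<cdot> \<iota> k j) = zero_arrow C (X k j) W" if "k \<in> I" "j \<in> J k" for k j
  proof -
    have "(k, j) \<in> p ` K" using that p by (simp add: bij_betw_def)
    then obtain m where "m \<in> K" "p m = (k, j)" by (metis imageE)
    then show ?thesis using u0[of m] by simp
  qed
  show "u = zero_arrow C T W"
  proof (rule coproduct_eqI[OF T u arr_zero[OF \<tau>(1) W]])
    fix k assume k: "k \<in> I"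
    note \<iota> = coproductD[OF Z[OF k]]
    have "u \<cdot> \<tau> k = zero_arrow C (Z k) W"
    proof (rule coproduct_eqI[OF Z[OF k] arr_Comp[OF \<tau>(2)[OF k] u] arr_zero[OF \<iota>(1) W]])
      fix j assume j: "j \<in> J k"
      show "(u \<cdot> \<tau> k) \<cdot> \<iota> k j = zero_arrow C (Z k) W \<cdot> \<iota> k j"
        using Comp_assoc'[OF \<iota>(2)[OF j] \<tau>(2)[OF k] u] u1[OF k j] Comp_zero_left[OF \<iota>(2)[OF j] W]
        by simp
    qed
    then show "u \<cdot> \<tau> k = zero_arrow C T W \<cdot> \<tau> k" using Comp_zero_left[OF \<tau>(2)[OF k] W] by simp
  qed
qed

section \<open>Smashing extension-closed classes\<close>

context triangulated_category
begin

definition big_closed :: "'u rel \<Rightarrow> 'a set \<Rightarrow> bool" where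
  "big_closed \<kappa> \<S> \<longleftrightarrow> \<S> \<subseteq> Obj C \<and> smashing C \<kappa> \<S> \<and> extension_closed C \<S>"

lemma big_closedI:
  assumes "\<S> \<subseteq> Obj C"
    and "\<And>I X Z \<iota>. \<lbrakk>small \<kappa> I; \<And>k. k \<in> I \<Longrightarrow> X k \<in> \<S>; is_coproduct C I X Z \<iota>\<rbrakk> \<Longrightarrow> Z \<in> \<S>"
    and "\<And>N. zero_object C N \<Longrightarrow> N \<in> \<S>"
    and "\<And>X Y Z f g h. \<lbrakk>X \<in> \<S>; Y \<in> \<S>; Dist C X Z Y f g h\<rbrakk> \<Longrightarrow> Z \<in> \<S>"
  shows "big_closed \<kappa> \<S>"
proof -
  have "smashing C \<kappa> \<S>"
    unfolding smashing_def small_coproducts_of_def Pi_def using assms(2) by blast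
  moreover have "extension_closed C \<S>"
    unfolding extension_closed_def star_def using assms(3,4) by blast
  ultimately show ?thesis using assms(1) by (simp add: big_closed_def)
qed

lemma big_closed_Obj: "\<lbrakk>big_closed \<kappa> \<S>; X \<in> \<S>\<rbrakk> \<Longrightarrow> X \<in> Obj C"
  unfolding big_closed_def by blast

lemma big_closed_coproduct:
  "\<lbrakk>big_closed \<kappa> \<S>; small \<kappa> I; \<And>k. k \<in> I \<Longrightarrow> X k \<in> \<S>; is_coproduct C I X Z \<iota>\<rbrakk> \<Longrightarrow> Z \<in> \<S>"
  unfolding big_closed_def smashing_def small_coproducts_of_def Pi_def by blast

lemma big_closed_zero: "\<lbrakk>big_closed \<kappa> \<S>; zero_object C N\<rbrakk> \<Longrightarrow> N \<in> \<S>"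
  unfolding big_closed_def extension_closed_def by blast

lemma big_closed_star: "big_closed \<kappa> \<S> \<Longrightarrow> star C \<S> \<S> \<subseteq> \<S>"
  unfolding big_closed_def extension_closed_def by blast

lemma big_closed_extension:
  "\<lbrakk>big_closed \<kappa> \<S>; X \<in> \<S>; Y \<in> \<S>; Dist C X Z Y f g h\<rbrakk> \<Longrightarrow> Z \<in> \<S>"
  using big_closed_star[of \<kappa> \<S>] unfolding star_def by blast

text \<open>An object isomorphic to \<open>X\<close> is an extension of 0 by
  \<open>X\<close>.\<close>

lemma big_closed_iso:
  assumes "big_closed \<kappa> \<S>" "X \<in> \<S>" "iso_arrow C X Y f" "Y \<in> Obj C"
  shows "Y \<in> \<S>"
proof -
  obtain N where N: "zero_object C N" using zero_object_exists by blast
  note X = big_closed_Obj[OF assms(1,2)]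
  obtain f' g' h' where "Dist C X Y N f' g' h'"
    by (rule Dist_iso'[OF Dist_Ident[OF X N] iso_arrow_Ident[OF X] X assms(3,4)
          iso_arrow_Ident[OF zero_object_Obj[OF N]] zero_object_Obj[OF N]])
  then show ?thesis
    using big_closed_extension[OF assms(1,2) big_closed_zero[OF assms(1) N]] by blast
qed

lemma big_closed_Obj_all: "big_closed \<kappa> (Obj C)"
  by (rule big_closedI) (auto intro: coproductD zero_object_Obj Dist_Obj)

lemma big_closed_closure:
  assumes "\<P> \<subseteq> Obj C"
  shows "big_closed \<kappa> (big_extension_closure C \<kappa> \<P>)"
proof -
  define F where "F = {\<S>. big_closed \<kappa> \<S> \<and> \<P> \<subseteq> \<S>}"
  have eq: "big_extension_closure C \<kappa> \<P> = \<Inter>F"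
    unfolding big_extension_closure_def F_def big_closed_def
    by (intro arg_cong[where f = Inter]) blast
  have F: "big_closed \<kappa> \<S>" if "\<S> \<in> F" for \<S> using that by (simp add: F_def)
  \<comment> \<open>The family is thus non-empty, which keeps its intersection inside
    \<open>Obj C\<close>.\<close>
  have "Obj C \<in> F" using big_closed_Obj_all assms by (simp add: F_def)
  show ?thesis
    unfolding eq
  proof (rule big_closedI)
    show "\<Inter>F \<subseteq> Obj C" using \<open>Obj C \<in> F\<close> by blast
    show "Z \<in> \<Inter>F" if "small \<kappa> I" "\<And>k. k \<in> I \<Longrightarrow> X k \<in> \<Inter>F" "is_coproduct C I X Z \<iota>" for I X Z \<iota>
      using big_closed_coproduct[OF F that(1) _ that(3)] that(2) by blast
    show "N \<in> \<Inter>F" if "zero_object C N" for N using big_closed_zero[OF F that] by blast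
    show "Z \<in> \<Inter>F" if "X \<in> \<Inter>F" "Y \<in> \<Inter>F" "Dist C X Z Y f g h" for X Y Z f g h
      using big_closed_extension[OF F _ _ that(3)] that(1,2) by blast
  qed
qed

lemma closure_least:
  "\<lbrakk>big_closed \<kappa> \<S>; \<P> \<subseteq> \<S>\<rbrakk> \<Longrightarrow> big_extension_closure C \<kappa> \<P> \<subseteq> \<S>"
  unfolding big_extension_closure_def big_closed_def by blast

lemma closure_contains: "\<P> \<subseteq> big_extension_closure C \<kappa> \<P>"
  unfolding big_extension_closure_def by blast

section \<open>Closed classes and the shift\<close>

text \<open>Serves to show that a closure is stable under the shift, and to express orthogonality to
  \<open>Y[1]\<close> or \<open>Y[2]\<close> as membership of \<open>Y\<close> in a closed
  class.\<close>

lemma big_closed_Sh_vimage: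
  assumes S: "big_closed \<kappa> \<S>"
  shows "big_closed \<kappa> {X \<in> Obj C. Sh C X \<in> \<S>}"
proof (rule big_closedI)
  show "Z \<in> {X \<in> Obj C. Sh C X \<in> \<S>}"
    if "small \<kappa> I" "\<And>k. k \<in> I \<Longrightarrow> X k \<in> {X \<in> Obj C. Sh C X \<in> \<S>}" "is_coproduct C I X Z \<iota>" for I X Z \<iota>
    using big_closed_coproduct[OF S that(1) _ coproduct_Sh[OF that(3)]] that(2) coproductD(1)[OF that(3)]
    by simp
  show "N \<in> {X \<in> Obj C. Sh C X \<in> \<S>}" if "zero_object C N" for N
    using big_closed_zero[OF S zero_object_Sh[OF that]] zero_object_Obj[OF that] by simp
  show "Z \<in> {X \<in> Obj C. Sh C X \<in> \<S>}"
    if XY: "X \<in> {X \<in> Obj C. Sh C X \<in> \<S>}" "Y \<in> {X \<in> Obj C. Sh C X \<in> \<S>}" and D: "Dist C X Z Y f g h"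
    for X Y Z f g h
  proof -
    obtain f' g' h' where "Dist C (Sh C X) (Sh C Z) (Sh C Y) f' g' h'" by (rule Dist_ShM[OF D])
    then show ?thesis using big_closed_extension[OF S] XY Dist_Obj(2)[OF D] by blast
  qed
qed blast

text \<open>The image of \<open>\<S>\<close> under the shift need not be closed under isomorphisms.\<close>

lemma big_closed_Sh_image:
  assumes S: "big_closed \<kappa> \<S>" and C: "has_small_coproducts C \<kappa>"
  shows "big_closed \<kappa> {Y \<in> Obj C. \<exists>X\<in>\<S>. \<exists>e. iso_arrow C (Sh C X) Y e}" (is "big_closed \<kappa> ?T")
proof (rule big_closedI)
  fix I X Z \<iota> assume I: "small \<kappa> I" and X: "\<And>k. k \<in> I \<Longrightarrow> X k \<in> ?T" and Z: "is_coproduct C I X Z \<iota>"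
  have "\<exists>Y e. Y \<in> \<S> \<and> iso_arrow C (Sh C Y) (X k) e" if "k \<in> I" for k using X[OF that] by blast
  then obtain Y e where Y: "Y k \<in> \<S>" "iso_arrow C (Sh C (Y k)) (X k) (e k)" if "k \<in> I" for k
    by metis
  then have "Y \<in> I \<rightarrow> Obj C" using big_closed_Obj[OF S] by blast
  then obtain V \<eta> where V: "is_coproduct C I Y V \<eta>"
    using C I unfolding has_small_coproducts_def by blast
  have VS: "V \<in> \<S>" by (rule big_closed_coproduct[OF S I Y(1) V])
  \<comment> \<open>\<open>Z\<close> is thereby a coproduct of the same family \<open>Y k[1]\<close>
    as \<open>V[1]\<close>, so the two are isomorphic.\<close>
  have "is_coproduct C I (\<lambda>k. Sh C (Y k)) Z (\<lambda>k. \<iota> k \<cdot> e k)"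
    by (rule coproduct_precomp_iso[OF Z]) (use Y big_closed_Obj[OF S] Sh_closed in auto)
  from coproduct_unique[OF coproduct_Sh[OF V] this] show "Z \<in> ?T"
    using VS coproductD(1)[OF Z] by blast
next
  fix N assume N: "zero_object C N"
  obtain V e where V: "V \<in> Obj C" "iso_arrow C (Sh C V) N e" "arr e (Sh C V) N"
    by (rule essentially_surjectiveE[OF zero_object_Obj[OF N]])
  obtain e' where e': "arr e' N (Sh C V)" "e' \<cdot> e = Ident C (Sh C V)"
    by (rule iso_arrowE[OF V(2) Sh_closed[OF V(1)] zero_object_Obj[OF N]])
  \<comment> \<open>The identity of \<open>Sh C V\<close> factors through the zero object
    \<open>N\<close> and so vanishes; faithfulness of the shift carries this down to
    \<open>V\<close>.\<close>
  have "e' = zero_arrow C N (Sh C V)"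
    using zero_object_unique_out[OF N e'(1)] arr_zero[OF arr_dom arr_cod, OF e'(1) e'(1)] by blast
  then have "Ident C (Sh C V) = ShM C (zero_arrow C V V)"
    using e'(2) Comp_zero_left[OF V(3) Sh_closed[OF V(1)]] ShM_zero[OF V(1,1)] by simp
  then have "Ident C V = zero_arrow C V V"
    using ShM_inj[OF arr_Ident[OF V(1)] arr_zero[OF V(1,1)]] ShM_Ident[OF V(1)] by simp
  then have "zero_object C V" using V(1) zero_object_iff by blast
  then show "N \<in> ?T" using big_closed_zero[OF S] V(2) zero_object_Obj[OF N] by blast
next
  fix X Y Z f g h assume X: "X \<in> ?T" and Y: "Y \<in> ?T" and D: "Dist C X Z Y f g h"
  note O = Dist_Obj[OF D]
  obtain X' a where X': "X' \<in> \<S>" "iso_arrow C (Sh C X') X a" using X by blast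
  obtain Y' c where Y': "Y' \<in> \<S>" "iso_arrow C (Sh C Y') Y c" using Y by blast
  have X'O: "X' \<in> Obj C" and Y'O: "Y' \<in> Obj C" using big_closed_Obj[OF S] X' Y' by blast+
  obtain a' where a': "iso_arrow C X (Sh C X') a'"
    by (rule iso_arrowE[OF X'(2) Sh_closed[OF X'O] O(1)])
  obtain c' where c': "iso_arrow C Y (Sh C Y') c'"
    by (rule iso_arrowE[OF Y'(2) Sh_closed[OF Y'O] O(3)])
  obtain Z' b b' where Z': "Z' \<in> Obj C" "iso_arrow C (Sh C Z') Z b" "iso_arrow C Z (Sh C Z') b'"
    by (rule essentially_surjectiveE[OF O(2)])
  obtain f1 g1 h1 where "Dist C (Sh C X') (Sh C Z') (Sh C Y') f1 g1 h1"
    by (rule Dist_iso'[OF D a' Sh_closed[OF X'O] Z'(3) Sh_closed[OF Z'(1)] c' Sh_closed[OF Y'O]])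
  then obtain f2 g2 h2 where "Dist C X' Z' Y' f2 g2 h2"
    by (rule Dist_unshift[OF _ X'O Z'(1) Y'O])
  then have "Z' \<in> \<S>" using big_closed_extension[OF S X'(1) Y'(1)] by blast
  then show "Z \<in> ?T" using Z'(2) O(2) by blast
qed blast

section \<open>Orthogonal classes\<close>

lemma hom_vanishesD: "\<lbrakk>hom_vanishes C X Y; arr f X Y\<rbrakk> \<Longrightarrow> f = zero_arrow C X Y"
  unfolding hom_vanishes_def arr_def by blast

lemma hom_vanishes_zero_dom: "\<lbrakk>zero_object C N; Y \<in> Obj C\<rbrakk> \<Longrightarrow> hom_vanishes C N Y"
  using zero_object_unique_out[of N _ Y "zero_arrow C N Y"] arr_zero[of N Y]
  by (simp add: hom_vanishes_iff zero_object_Obj)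

lemma hom_vanishes_zero_cod: "\<lbrakk>zero_object C N; X \<in> Obj C\<rbrakk> \<Longrightarrow> hom_vanishes C X N"
  using zero_object_unique_in[of N _ X "zero_arrow C X N"] arr_zero[of X N]
  by (simp add: hom_vanishes_iff zero_object_Obj)

text \<open>Morphisms into \<open>Y\<close> turn coproducts into products, and they are exact on
  triangles.\<close>

lemma big_closed_left_orthogonal:
  assumes Y: "Y \<in> Obj C"
  shows "big_closed \<kappa> {X \<in> Obj C. hom_vanishes C X Y}" (is "big_closed \<kappa> ?S")
proof (rule big_closedI)
  fix I X Z \<iota> assume X: "\<And>k. k \<in> I \<Longrightarrow> X k \<in> ?S" and Z: "is_coproduct C I X Z \<iota>"
  note \<iota> = coproductD[OF Z]
  have "u = zero_arrow C Z Y" if u: "arr u Z Y" for u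
  proof (rule coproduct_eqI[OF Z u arr_zero[OF \<iota>(1) Y]])
    fix k assume k: "k \<in> I"
    show "u \<cdot> \<iota> k = zero_arrow C Z Y \<cdot> \<iota> k"
      using hom_vanishesD[OF _ arr_Comp[OF \<iota>(2)[OF k] u]] X[OF k] Comp_zero_left[OF \<iota>(2)[OF k] Y]
      by simp
  qed
  then show "Z \<in> ?S" using \<iota>(1) Y by (simp add: hom_vanishes_iff)
next
  show "N \<in> ?S" if "zero_object C N" for N
    using that Y by (simp add: hom_vanishes_zero_dom zero_object_Obj)
next
  fix X X' Z f g h assume X: "X \<in> ?S" "X' \<in> ?S" and D: "Dist C X Z X' f g h"
  note O = Dist_Obj[OF D] and A = Dist_arr[OF D]
  have "u = zero_arrow C Z Y" if u: "arr u Z Y" for u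
  proof -
    have "u \<cdot> f = zero_arrow C X Y" using hom_vanishesD[OF _ arr_Comp[OF A(1) u]] X(1) by simp
    then obtain v where v: "arr v X' Y" "v \<cdot> g = u" by (rule Dist_factor_out[OF D u])
    then show ?thesis using hom_vanishesD[OF _ v(1)] X(2) Comp_zero_left[OF A(2) Y] by simp
  qed
  then show "Z \<in> ?S" using O(2) Y by (simp add: hom_vanishes_iff)
qed blast

text \<open>Compactness makes every morphism from \<open>P\<close> to a coproduct a finite sum of
  morphisms through the summands, each of which vanishes.\<close>

lemma big_closed_right_orthogonal:
  assumes P: "compact_object C \<kappa> P"
  shows "big_closed \<kappa> {Y \<in> Obj C. hom_vanishes C P Y}" (is "big_closed \<kappa> ?S")
proof (rule big_closedI)
  have PO: "P \<in> Obj C" using P by (simp add: compact_object_def)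
  fix I X Z \<iota> assume I: "small \<kappa> I" and X: "\<And>k. k \<in> I \<Longrightarrow> X k \<in> ?S" and Z: "is_coproduct C I X Z \<iota>"
  note \<iota> = coproductD[OF Z]
  have surj: "(\<lambda>x. gfinprod (Mor C P Z) (\<lambda>k. \<iota> k \<cdot> x k) I)
      ` carrier (sum_group I (\<lambda>k. Mor C P (X k))) = arrows C P Z"
    using P I Z unfolding compact_object_def iso_def bij_betw_def by blast
  interpret G: comm_group "Mor C P Z" by (rule Mor_comm_group[OF PO \<iota>(1)])
  have "u = zero_arrow C P Z" if u: "arr u P Z" for u
  proof -
    have "u \<in> (\<lambda>x. gfinprod (Mor C P Z) (\<lambda>k. \<iota> k \<cdot> x k) I)
      ` carrier (sum_group I (\<lambda>k. Mor C P (X k)))"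
      unfolding surj using u by (simp add: arr_def)
    then obtain x where x: "x \<in> carrier (sum_group I (\<lambda>k. Mor C P (X k)))"
      "u = gfinprod (Mor C P Z) (\<lambda>k. \<iota> k \<cdot> x k) I" by blast
    have 0: "\<iota> k \<cdot> x k = zero_arrow C P Z" if k: "k \<in> I" for k
    proof -
      have "x k \<in> arrows C P (X k)"
        using x(1) k PO \<iota>(2) by (auto simp: carrier_sum_group Mor_group arr_def PiE_def Pi_def)
      then have "x k = zero_arrow C P (X k)"
        using X[OF k] unfolding hom_vanishes_def by blast
      then show ?thesis using Comp_zero_right[OF \<iota>(2)[OF k] PO] by simp
    qed
    \<comment> \<open>With empty support \<open>gfinprod\<close> is an empty product, that is, the
      zero morphism.\<close>
    then have supp: "{k \<in> I. \<iota> k \<cdot> x k \<noteq> zero_arrow C P Z} = {}" by blast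
    show ?thesis unfolding x(2) gfinprod_def supp by simp
  qed
  then show "Z \<in> ?S" using \<iota>(1) PO by (simp add: hom_vanishes_iff)
next
  have PO: "P \<in> Obj C" using P by (simp add: compact_object_def)
  show "N \<in> ?S" if "zero_object C N" for N
    using that PO by (simp add: hom_vanishes_zero_cod zero_object_Obj)
  fix Y Y' Z f g h assume Y: "Y \<in> ?S" "Y' \<in> ?S" and D: "Dist C Y Z Y' f g h"
  note O = Dist_Obj[OF D] and A = Dist_arr[OF D]
  have "u = zero_arrow C P Z" if u: "arr u P Z" for u
  proof -
    have "g \<cdot> u = zero_arrow C P Y'" using hom_vanishesD[OF _ arr_Comp[OF u A(2)]] Y(2) by simp
    then obtain v where v: "arr v P Y" "f \<cdot> v = u" by (rule Dist_factor_in[OF D u])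
    then show ?thesis using hom_vanishesD[OF _ v(1)] Y(1) Comp_zero_right[OF A(1) PO] by simp
  qed
  then show "Z \<in> ?S" using O(2) PO by (simp add: hom_vanishes_iff)
qed blast

section \<open>Products of classes\<close>

lemma star_mono: "\<lbrakk>\<X> \<subseteq> \<X>'; \<Y> \<subseteq> \<Y>'\<rbrakk> \<Longrightarrow> star C \<X> \<Y> \<subseteq> star C \<X>' \<Y>'"
  unfolding star_def by blast

lemma star_contains_left:
  assumes "\<X> \<subseteq> Obj C" "zero_object C N" "N \<in> \<Y>"
  shows "\<X> \<subseteq> star C \<X> \<Y>"
  unfolding star_def using assms Dist_Ident by blast

lemma star_contains_right:
  assumes "\<Y> \<subseteq> Obj C" "zero_object C N" "N \<in> \<X>"
  shows "\<Y> \<subseteq> star C \<X> \<Y>"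
  unfolding star_def using assms Dist_Ident' by blast

text \<open>The connecting arrow of an extension of \<open>X\<close> by \<open>Y\<close> lies in a
  vanishing group, so the triangle splits and its ends can be exchanged.\<close>

lemma star_commute:
  assumes "\<And>X Y. \<lbrakk>X \<in> \<X>; Y \<in> \<Y>\<rbrakk> \<Longrightarrow> hom_vanishes C X (Sh C Y)"
  shows "star C \<Y> \<X> \<subseteq> star C \<X> \<Y>"
proof
  fix Z assume "Z \<in> star C \<Y> \<X>"
  then obtain Y X f g h where *: "Y \<in> \<Y>" "X \<in> \<X>" "Dist C Y Z X f g h"
    unfolding star_def by blast
  obtain s r h' where "Dist C X Z Y s r h'"
    by (rule Dist_split_swap[OF *(3) hom_vanishesD[OF assms[OF *(2,1)] Dist_arr(3)[OF *(3)]]])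
  then show "Z \<in> star C \<X> \<Y>" unfolding star_def using * by blast
qed

lemma big_closed_star_orthogonal:
  assumes X: "big_closed \<kappa> \<X>" and Y: "big_closed \<kappa> \<Y>" and C: "has_small_coproducts C \<kappa>"
    and orth: "\<And>X Y. \<lbrakk>X \<in> \<X>; Y \<in> \<Y>\<rbrakk> \<Longrightarrow> hom_vanishes C X (Sh C Y)"
  shows "big_closed \<kappa> (star C \<X> \<Y>)"
  unfolding big_closed_def smashing_def extension_closed_def
proof (intro conjI allI impI)
  show "star C \<X> \<Y> \<subseteq> Obj C" unfolding star_def using Dist_Obj(2) by blast
  show "N \<in> star C \<X> \<Y>" if "zero_object C N" for N
    using star_contains_left[of \<X> N \<Y>] X Y big_closed_zero that unfolding big_closed_def by blast
  let ?S = "star C \<X> \<Y>"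
  have "star C ?S ?S \<subseteq> star C \<X> (star C \<Y> ?S)" by (rule star_assoc_right)
  also have "\<dots> \<subseteq> star C \<X> (star C (star C \<Y> \<X>) \<Y>)"
    by (intro star_mono star_assoc_left order_refl)
  also have "\<dots> \<subseteq> star C \<X> (star C (star C \<X> \<Y>) \<Y>)"
    by (intro star_mono star_commute orth order_refl)
  also have "\<dots> \<subseteq> star C \<X> (star C \<X> (star C \<Y> \<Y>))"
    by (intro star_mono star_assoc_right order_refl)
  also have "\<dots> \<subseteq> star C \<X> (star C \<X> \<Y>)"
    by (intro star_mono big_closed_star[OF Y] order_refl)
  also have "\<dots> \<subseteq> star C (star C \<X> \<X>) \<Y>" by (rule star_assoc_left)
  also have "\<dots> \<subseteq> ?S" by (intro star_mono big_closed_star[OF X] order_refl)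
  finally show "star C ?S ?S \<subseteq> ?S" .
  show "small_coproducts_of C \<kappa> ?S \<subseteq> ?S"
  proof
    fix T assume "T \<in> small_coproducts_of C \<kappa> ?S"
    then obtain I Z \<tau> where I: "small \<kappa> I" and Z: "Z \<in> I \<rightarrow> ?S" and T: "is_coproduct C I Z T \<tau>"
      unfolding small_coproducts_of_def by blast
    have "\<forall>k\<in>I. \<exists>A B f g h. A \<in> \<X> \<and> B \<in> \<Y> \<and> Dist C A (Z k) B f g h"
      using Z unfolding star_def by blast
    then obtain A B f g h
      where ABD: "\<forall>k\<in>I. A k \<in> \<X> \<and> B k \<in> \<Y> \<and> Dist C (A k) (Z k) (B k) (f k) (g k) (h k)"
      by metis
    then have AB: "A k \<in> \<X>" "B k \<in> \<Y>" and D: "Dist C (A k) (Z k) (B k) (f k) (g k) (h k)"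
      if "k \<in> I" for k using that by blast+
    have "A \<in> I \<rightarrow> Obj C" using AB big_closed_Obj[OF X] by blast
    then obtain A' \<iota> where A': "is_coproduct C I A A' \<iota>"
      using C I unfolding has_small_coproducts_def by blast
    \<comment> \<open>To exhibit \<open>T\<close> as an extension, take the morphism from the
      coproduct of the left ends \<open>A k\<close> to \<open>T\<close> and let \<open>B'\<close> be
      its cone; \<open>B'\<close> turns out to be a coproduct of the right ends
      \<open>B k\<close>.\<close>
    have "arr (\<tau> k \<cdot> f k) (A k) T" if "k \<in> I" for k
      using arr_Comp[OF Dist_arr(1)[OF D[OF that]] coproductD(2)[OF T that]] .
    then obtain f' where f': "arr f' A' T" "\<forall>k\<in>I. f' \<cdot> \<iota> k = \<tau> k \<cdot> f k"
      by (rule coproduct_lift[OF A' coproductD(1)[OF T]])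
    obtain B' g' h' where D': "Dist C A' T B' f' g' h'" by (rule Dist_completeE[OF f'(1)])
    obtain \<zeta> where "is_coproduct C I B B' \<zeta>"
      using coproduct_of_cones[OF D A' T D'] f'(2) by blast
    from big_closed_coproduct[OF Y I AB(2) this] have "B' \<in> \<Y>" by blast
    moreover have "A' \<in> \<X>" by (rule big_closed_coproduct[OF X I AB(1) A'])
    ultimately show "T \<in> ?S" unfolding star_def using D' by blast
  qed
qed

section \<open>Classes of coproducts\<close>

lemma coproducts_within_big_closed:
  "\<lbrakk>big_closed \<kappa> \<S>; \<P> \<subseteq> \<S>\<rbrakk> \<Longrightarrow> small_coproducts_of C \<kappa> \<P> \<subseteq> \<S>"
  unfolding big_closed_def smashing_def small_coproducts_of_def by blast

lemma small_coproducts_contain: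
  fixes \<kappa> :: "'u rel"
  assumes \<kappa>: "smallness_cardinal \<kappa>" and P: "\<P> \<subseteq> Obj C"
  shows "\<P> \<subseteq> small_coproducts_of C \<kappa> \<P>"
proof
  fix X assume X: "X \<in> \<P>"
  then have XO: "X \<in> Obj C" using P by blast
  \<comment> \<open>Any index will do: a one-term coproduct needs just some element of the index
    type.\<close>
  let ?a = "undefined :: 'u"
  have "is_coproduct C {?a} (\<lambda>_. X) X (\<lambda>_. Ident C X)"
  proof (rule coproductI)
    show "\<exists>u. arr u X W \<and> (\<forall>k\<in>{?a}. u \<cdot> Ident C X = \<phi> k)"
      if "\<And>k. k \<in> {?a} \<Longrightarrow> arr (\<phi> k) X W" for W \<phi>
      using that[of ?a] Comp_Ident_right' by auto
    show "u = zero_arrow C X W"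
      if "arr u X W" "\<And>k. k \<in> {?a} \<Longrightarrow> u \<cdot> Ident C X = zero_arrow C X W" for W u
      using that(2)[of ?a] Comp_Ident_right'[OF that(1)] by simp
  qed (use XO arr_Ident in auto)
  moreover have "small \<kappa> {?a}" using small_finite[OF \<kappa>] by blast
  moreover have "(\<lambda>_. X) \<in> {?a} \<rightarrow> \<P>" using X by simp
  ultimately show "X \<in> small_coproducts_of C \<kappa> \<P>"
    unfolding small_coproducts_of_def by blast
qed

text \<open>The step that consumes compactness: the source is still \<open>P\<close>, while the
  target spreads to coproducts.\<close>

lemma coproducts_orthogonal_right:
  assumes P: "compact_object C \<kappa> P" and P': "\<P>' \<subseteq> Obj C"
    and orth: "\<And>P'. P' \<in> \<P>' \<Longrightarrow> hom_vanishes C P (Sh C P')"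
    and Q: "Q \<in> small_coproducts_of C \<kappa> \<P>'"
  shows "hom_vanishes C P (Sh C Q)"
proof -
  have "\<P>' \<subseteq> {Y \<in> Obj C. Sh C Y \<in> {Y \<in> Obj C. hom_vanishes C P Y}}"
    using P' orth Sh_closed by blast
  from coproducts_within_big_closed[OF big_closed_Sh_vimage[OF big_closed_right_orthogonal[OF P]] this]
  show ?thesis using Q by blast
qed

lemma coproducts_orthogonal_left:
  assumes Y: "Y \<in> Obj C" and P: "\<P> \<subseteq> Obj C"
    and orth: "\<And>P. P \<in> \<P> \<Longrightarrow> hom_vanishes C P Y"
    and Q: "Q \<in> small_coproducts_of C \<kappa> \<P>"
  shows "hom_vanishes C Q Y"
proof -
  have "\<P> \<subseteq> {X \<in> Obj C. hom_vanishes C X Y}" using P orth by blast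
  from coproducts_within_big_closed[OF big_closed_left_orthogonal[OF Y] this]
  show ?thesis using Q by blast
qed

text \<open>Orthogonality makes an extension of two such coproducts split, hence a two-term
  coproduct of coproducts, and these flatten into one.\<close>

lemma big_closed_small_coproducts:
  fixes \<kappa> :: "'u rel"
  assumes \<kappa>: "smallness_cardinal \<kappa>" and P: "\<P> \<subseteq> Obj C"
    and compact: "\<And>P. P \<in> \<P> \<Longrightarrow> compact_object C \<kappa> P"
    and orth: "\<And>P P'. \<lbrakk>P \<in> \<P>; P' \<in> \<P>\<rbrakk> \<Longrightarrow> hom_vanishes C P (Sh C P')"
  shows "big_closed \<kappa> (small_coproducts_of C \<kappa> \<P>)" (is "big_closed \<kappa> ?Q")
proof -
  have QO: "?Q \<subseteq> Obj C" unfolding small_coproducts_of_def using coproductD(1) by blast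
  have coprod: "T \<in> ?Q"
    if I: "small \<kappa> I" and Z: "\<And>k. k \<in> I \<Longrightarrow> Z k \<in> ?Q" and T: "is_coproduct C I Z T \<tau>" for I Z T \<tau>
  proof -
    have "\<forall>k\<in>I. \<exists>J X \<iota>. small \<kappa> J \<and> X \<in> J \<rightarrow> \<P> \<and> is_coproduct C J X (Z k) \<iota>"
      using Z unfolding small_coproducts_of_def by blast
    then obtain J X \<iota> where *: "\<forall>k\<in>I. small \<kappa> (J k) \<and> X k \<in> J k \<rightarrow> \<P> \<and>
        is_coproduct C (J k) (X k) (Z k) (\<iota> k)"
      by metis
    obtain K :: "'u set" and p where K: "small \<kappa> K" and p: "bij_betw p K (Sigma I J)"
      using small_Sigma_copy[OF \<kappa> I, of J] * by blast
    have "is_coproduct C K (\<lambda>m. X (fst (p m)) (snd (p m))) T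
        (\<lambda>m. \<tau> (fst (p m)) \<cdot> \<iota> (fst (p m)) (snd (p m)))"
      by (rule coproduct_Sigma[OF T _ p]) (use * in blast)
    moreover have "(\<lambda>m. X (fst (p m)) (snd (p m))) \<in> K \<rightarrow> \<P>"
    proof
      fix m assume "m \<in> K"
      then have "p m \<in> Sigma I J" using bij_betwE[OF p] by blast
      then have "fst (p m) \<in> I" "snd (p m) \<in> J (fst (p m))" by auto
      then show "X (fst (p m)) (snd (p m)) \<in> \<P>" using * by (blast dest: funcset_mem)
    qed
    ultimately show ?thesis unfolding small_coproducts_of_def using K by blast
  qed
  show ?thesis
  proof (rule big_closedI[OF QO coprod])
    fix N assume N: "zero_object C N"
    have "is_coproduct C {} (\<lambda>_. N) N (\<lambda>_. Ident C N)" using N empty_coproduct_iff by blast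
    moreover have "small \<kappa> {}" using small_finite[OF \<kappa>] by blast
    ultimately show "N \<in> ?Q" unfolding small_coproducts_of_def by blast
  next
    fix X Y Z f g h assume X: "X \<in> ?Q" and Y: "Y \<in> ?Q" and D: "Dist C X Z Y f g h"
    \<comment> \<open>The target comes first, because the coproduct \<open>Y\<close> is not known to
      be compact; the source spreads from \<open>P\<close> to \<open>Y\<close> afterwards.\<close>
    have "hom_vanishes C P (Sh C X)" if "P \<in> \<P>" for P
      using coproducts_orthogonal_right[OF compact[OF that] P orth[OF that] X] .
    then have "hom_vanishes C Y (Sh C X)"
      using coproducts_orthogonal_left[OF Sh_closed[OF Dist_Obj(1)[OF D]] P _ Y] by blast
    then have h: "h = zero_arrow C Y (Sh C X)" using hom_vanishesD Dist_arr(3)[OF D] by blast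
    \<comment> \<open>The infinite cardinal \<kappa> provides two distinct indices for the binary
      coproduct.\<close>
    obtain a b :: 'u where "a \<noteq> b" by (rule smallness_cardinal_two_elements[OF \<kappa>])
    from Dist_split_coproduct[OF D h this] obtain \<iota>
      where Z: "is_coproduct C {a, b} (\<lambda>k. if k = a then X else Y) Z \<iota>" by blast
    have "small \<kappa> {a, b}" by (rule small_finite[OF \<kappa>]) simp
    then show "Z \<in> ?Q" by (rule coprod[OF _ _ Z]) (use X Y in auto)
  qed
qed

section \<open>The first claim\<close>

lemma closure_eq_star_shift:
  assumes \<kappa>: "has_small_coproducts C \<kappa>" and P: "\<P> \<subseteq> Obj C"
    and compact: "\<And>P. P \<in> \<P> \<Longrightarrow> compact_object C \<kappa> P"
    and neg: "weakly_negative C \<P>"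
  defines "A \<equiv> big_extension_closure C \<kappa> \<P>"
    and "B \<equiv> big_extension_closure C \<kappa> (\<Union>i. shift_class C i \<P>)"
  shows "B = star C A (shift_class C 1 B)"
proof
  have Sh_pow: "(Sh C ^^ i) X \<in> Obj C" if "X \<in> \<P>" for X i
    using that P Sh_closed by (induction i) auto
  then have shifts: "(\<Union>i. shift_class C i \<P>) \<subseteq> Obj C" by (auto simp: shift_class_def)
  have cA: "big_closed \<kappa> A" and cB: "big_closed \<kappa> B"
    unfolding A_def B_def by (intro big_closed_closure P shifts)+
  have PB: "(Sh C ^^ i) X \<in> B" if "X \<in> \<P>" for X i
    using closure_contains[of "\<Union>i. shift_class C i \<P>" \<kappa>] that
    unfolding B_def shift_class_def by blast
  have PA: "\<P> \<subseteq> A" unfolding A_def by (rule closure_contains)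
  have "\<P> \<subseteq> B" using PB[of _ 0] by auto
  then have AB: "A \<subseteq> B" unfolding A_def by (rule closure_least[OF cB])
  \<comment> \<open>Stability of \<open>B\<close> under the shift: the preimage of \<open>B\<close>
    is closed, and it contains the generators because these are permuted upwards by the
    shift.\<close>
  have "B \<subseteq> {X \<in> Obj C. Sh C X \<in> B}"
    unfolding B_def
  proof (rule closure_least[OF big_closed_Sh_vimage[OF cB[unfolded B_def]]])
    show "(\<Union>i. shift_class C i \<P>) \<subseteq>
        {X \<in> Obj C. Sh C X \<in> big_extension_closure C \<kappa> (\<Union>i. shift_class C i \<P>)}"
      using PB[of _ "Suc _"] Sh_pow unfolding B_def shift_class_def by auto
  qed
  then have "shift_class C 1 B \<subseteq> B" unfolding shift_class_def by auto
  then have "star C A (shift_class C 1 B) \<subseteq> star C B B" using AB by (rule star_mono[rotated])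
  also have "\<dots> \<subseteq> B" by (rule big_closed_star[OF cB])
  finally show "star C A (shift_class C 1 B) \<subseteq> B" .
  \<comment> \<open>\<open>B[1]\<close> completed under isomorphism, so that it becomes a closed
    class.\<close>
  let ?Y = "{Y \<in> Obj C. \<exists>X\<in>B. \<exists>e. iso_arrow C (Sh C X) Y e}"
  have cY: "big_closed \<kappa> ?Y" by (rule big_closed_Sh_image[OF cB \<kappa>])
  have ShY: "Sh C X \<in> ?Y" if "X \<in> B" for X
    using that big_closed_Obj[OF cB that] Sh_closed iso_arrow_Ident by blast
  have PB0: "hom_vanishes C P (Sh C (Sh C b))" if Pm: "P \<in> \<P>" and b: "b \<in> B" for P b
  proof -
    \<comment> \<open>The objects \<open>Y\<close> with no non-zero morphisms from \<open>P\<close>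
      to \<open>Y[2]\<close>. A generator \<open>P'[i]\<close> belongs here because
      \<open>i + 2 > 1\<close>.\<close>
    let ?V = "{Y \<in> Obj C. Sh C Y \<in> {Y \<in> Obj C. Sh C Y \<in> {Y \<in> Obj C. hom_vanishes C P Y}}}"
    have "(Sh C ^^ i) P' \<in> ?V" if "P' \<in> \<P>" for i P'
    proof -
      have "hom_vanishes C P ((Sh C ^^ Suc (Suc i)) P')"
        using neg Pm that unfolding weakly_negative_def
        by (metis One_nat_def Suc_less_eq zero_less_Suc)
      then show ?thesis using Sh_pow[OF that] Sh_closed by simp
    qed
    then have "(\<Union>i. shift_class C i \<P>) \<subseteq> ?V" unfolding shift_class_def by blast
    from closure_least[OF big_closed_Sh_vimage[OF big_closed_Sh_vimage[OF
          big_closed_right_orthogonal[OF compact[OF Pm]]]] this]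
    show ?thesis using b unfolding B_def by blast
  qed
  have PY: "hom_vanishes C P (Sh C Y)" if Pm: "P \<in> \<P>" and Y: "Y \<in> ?Y" for P Y
  proof -
    let ?V = "{Y \<in> Obj C. Sh C Y \<in> {Y \<in> Obj C. hom_vanishes C P Y}}"
    have cV: "big_closed \<kappa> ?V"
      by (rule big_closed_Sh_vimage[OF big_closed_right_orthogonal[OF compact[OF Pm]]])
    obtain X e where X: "X \<in> B" "iso_arrow C (Sh C X) Y e" "Y \<in> Obj C" using Y by blast
    \<comment> \<open>Elements of \<open>?Y\<close> are only isomorphic to shifts from
      \<open>B\<close>; a closed class such as \<open>?V\<close> absorbs the difference.\<close>
    have "Sh C X \<in> ?V" using PB0[OF Pm X(1)] big_closed_Obj[OF cB X(1)] Sh_closed by simp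
    then have "Y \<in> ?V" by (rule big_closed_iso[OF cV _ X(2,3)])
    then show ?thesis by blast
  qed
  have orth: "hom_vanishes C X (Sh C Y)" if X: "X \<in> A" and Y: "Y \<in> ?Y" for X Y
  proof -
    have YO: "Sh C Y \<in> Obj C" using Y Sh_closed by blast
    have "\<P> \<subseteq> {X \<in> Obj C. hom_vanishes C X (Sh C Y)}" using P PY[OF _ Y] by blast
    from closure_least[OF big_closed_left_orthogonal[OF YO] this]
    show ?thesis using X unfolding A_def by blast
  qed
  have cS: "big_closed \<kappa> (star C A ?Y)" by (rule big_closed_star_orthogonal[OF cA cY \<kappa> orth])
  obtain N where N: "zero_object C N" using zero_object_exists by blast
  have A1: "A \<subseteq> star C A ?Y"
    using star_contains_left[OF _ N big_closed_zero[OF cY N]] cA unfolding big_closed_def by blast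
  have Y1: "?Y \<subseteq> star C A ?Y"
    by (rule star_contains_right[OF _ N big_closed_zero[OF cA N]]) blast
  \<comment> \<open>Unshifted generators come from the left factor \<open>A\<close>; a generator
    shifted \<open>j + 1\<close> times is the shift of an element of \<open>B\<close> and comes from
    the right factor.\<close>
  have "(Sh C ^^ i) X \<in> star C A ?Y" if X: "X \<in> \<P>" for i X
  proof (cases i)
    case 0 then show ?thesis using X PA A1 by auto
  next
    case (Suc j)
    have "Sh C ((Sh C ^^ j) X) \<in> ?Y" by (rule ShY[OF PB[OF X]])
    then show ?thesis using Y1 Suc by auto
  qed
  then have "(\<Union>i. shift_class C i \<P>) \<subseteq> star C A ?Y" unfolding shift_class_def by blast
  then have "B \<subseteq> star C A ?Y" unfolding B_def by (rule closure_least[OF cS[unfolded B_def]])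
  \<comment> \<open>Back to literal shifts: the right end of the triangle is replaced by an
    isomorphic object of the form \<open>Sh C b\<close>.\<close>
  also have "\<dots> \<subseteq> star C A (shift_class C 1 B)"
  proof
    fix Z assume "Z \<in> star C A ?Y"
    then obtain X Y f g h where Z: "X \<in> A" "Y \<in> ?Y" "Dist C X Z Y f g h"
      unfolding star_def by blast
    then obtain b e where b: "b \<in> B" "iso_arrow C (Sh C b) Y e" by blast
    note O = Dist_Obj[OF Z(3)] and Sb = Sh_closed[OF big_closed_Obj[OF cB b(1)]]
    obtain e' where e': "iso_arrow C Y (Sh C b) e'" by (rule iso_arrowE[OF b(2) Sb O(3)])
    obtain f' g' h' where "Dist C X Z (Sh C b) f' g' h'"
      by (rule Dist_iso'[OF Z(3) iso_arrow_Ident[OF O(1)] O(1) iso_arrow_Ident[OF O(2)] O(2) e' Sb])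
    moreover have "Sh C b \<in> shift_class C 1 B" using b(1) unfolding shift_class_def by auto
    ultimately show "Z \<in> star C A (shift_class C 1 B)" using Z(1) unfolding star_def by blast
  qed
  finally show "B \<subseteq> star C A (shift_class C 1 B)" .
qed

section \<open>The second claim\<close>

lemma iterated_star_eq_closure:
  fixes \<kappa> :: "'u rel" and \<P>\<^sub>i :: "nat \<Rightarrow> 'a set"
  assumes \<kappa>: "smallness_cardinal \<kappa>" and C: "has_small_coproducts C \<kappa>" and P: "\<P> \<subseteq> Obj C"
    and compact: "\<And>P. P \<in> \<P> \<Longrightarrow> compact_object C \<kappa> P"
    and Pi: "\<P> = (\<Union>i\<in>{0..n}. \<P>\<^sub>i i)"
    and orth: "\<And>i j P P'. \<lbrakk>i \<le> j; j \<le> n; P \<in> \<P>\<^sub>i i; P' \<in> \<P>\<^sub>i j\<rbrakk> \<Longrightarrow> hom_vanishes C P (Sh C P')"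
  shows "iterated_star C (\<lambda>i. small_coproducts_of C \<kappa> (\<P>\<^sub>i i)) n = big_extension_closure C \<kappa> \<P>"
proof
  let ?Q = "\<lambda>i. small_coproducts_of C \<kappa> (\<P>\<^sub>i i)"
  let ?S = "iterated_star C ?Q"
  let ?A = "big_extension_closure C \<kappa> \<P>"
  have PiP: "\<P>\<^sub>i i \<subseteq> \<P>" if "i \<le> n" for i using that Pi by auto
  have PO: "\<P>\<^sub>i i \<subseteq> Obj C" if "i \<le> n" for i using PiP[OF that] P by blast
  have Pc: "compact_object C \<kappa> P" if "i \<le> n" "P \<in> \<P>\<^sub>i i" for i P
    using compact PiP[OF that(1)] that(2) by blast
  \<comment> \<open>This is the case \<open>i = j\<close> of the orthogonality hypothesis.\<close>
  have cQ: "big_closed \<kappa> (?Q i)" if "i \<le> n" for i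
    by (rule big_closed_small_coproducts[OF \<kappa> PO[OF that] Pc[OF that]])
      (assumption, rule orth[OF order_refl that])
  obtain N where N: "zero_object C N" using zero_object_exists by blast
  \<comment> \<open>Used twice: with the closure of \<P> for one inclusion of the claim, and with
    left orthogonal classes to spread orthogonality over the partial product.\<close>
  have S_least: "?S m \<subseteq> \<S>" if "big_closed \<kappa> \<S>" "\<And>i. i \<le> m \<Longrightarrow> \<P>\<^sub>i i \<subseteq> \<S>" for m \<S>
    using that(2)
  proof (induction m)
    case 0 then show ?case using coproducts_within_big_closed[OF that(1)] by simp
  next
    case (Suc m)
    have "star C (?S m) (?Q (Suc m)) \<subseteq> star C \<S> \<S>"
      by (intro star_mono Suc.IH coproducts_within_big_closed[OF that(1)] Suc.prems) simp_all
    then show ?case using big_closed_star[OF that(1)] by auto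
  qed
  \<comment> \<open>The containment of the earlier \<open>\<P>\<^sub>i i\<close> is carried along in
    the induction: at \<open>m = n\<close> it shows that the closed product contains all
    generators.\<close>
  have S: "big_closed \<kappa> (?S m) \<and> (\<forall>i\<le>m. \<P>\<^sub>i i \<subseteq> ?S m)" if "m \<le> n" for m
    using that
  proof (induction m)
    case 0
    then show ?case using cQ[of 0] small_coproducts_contain[OF \<kappa> PO[of 0]] by simp
  next
    case (Suc m)
    then have IH: "big_closed \<kappa> (?S m)" "\<forall>i\<le>m. \<P>\<^sub>i i \<subseteq> ?S m" by auto
    note cQ' = cQ[OF Suc.prems]
    \<comment> \<open>For a source in an earlier \<open>\<P>\<^sub>i i\<close>, compactness spreads
      the vanishing over the targets \<open>Y\<close>. With \<open>Y\<close> fixed, the left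
      orthogonal class is closed and hence contains the whole partial product.\<close>
    have orth': "hom_vanishes C X (Sh C Y)" if X: "X \<in> ?S m" and Y: "Y \<in> ?Q (Suc m)" for X Y
    proof -
      have YO: "Sh C Y \<in> Obj C" using big_closed_Obj[OF cQ' Y] Sh_closed by blast
      have "\<P>\<^sub>i i \<subseteq> {X \<in> Obj C. hom_vanishes C X (Sh C Y)}" if i: "i \<le> m" for i
      proof
        fix R assume R: "R \<in> \<P>\<^sub>i i"
        have le: "i \<le> n" "i \<le> Suc m" using i Suc.prems by simp_all
        have "hom_vanishes C R (Sh C Y)"
          by (rule coproducts_orthogonal_right[OF Pc[OF le(1) R] PO[OF Suc.prems] _ Y])
            (rule orth[OF le(2) Suc.prems R])
        then show "R \<in> {X \<in> Obj C. hom_vanishes C X (Sh C Y)}" using PO[OF le(1)] R by blast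
      qed
      from S_least[OF big_closed_left_orthogonal[OF YO] this] show ?thesis using X by blast
    qed
    have "big_closed \<kappa> (?S (Suc m))"
      using big_closed_star_orthogonal[OF IH(1) cQ' C orth'] by simp
    moreover have "?S m \<subseteq> ?S (Suc m)"
      using star_contains_left[OF _ N big_closed_zero[OF cQ' N]] IH(1)
      by (simp add: big_closed_def)
    moreover have "\<P>\<^sub>i (Suc m) \<subseteq> ?S (Suc m)"
      using star_contains_right[OF _ N big_closed_zero[OF IH(1) N]] cQ'
        small_coproducts_contain[OF \<kappa> PO[OF Suc.prems]]
      unfolding big_closed_def iterated_star.simps by blast
    ultimately show ?case using IH(2) by (auto simp: le_Suc_eq simp del: iterated_star.simps)
  qed
  show "?S n \<subseteq> ?A"
    by (rule S_least[OF big_closed_closure[OF P]]) (use PiP closure_contains in blast)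
  show "?A \<subseteq> ?S n"
    by (rule closure_least) (use S[of n] Pi in auto)
qed

end

theorem theorem3p2:
  fixes C :: "('o, 'm) tri_cat" and \<kappa> :: "'u rel" and \<P> :: "'o set"
  assumes "triangulated_category C"
    and "smallness_cardinal \<kappa>"
    and "has_small_coproducts C \<kappa>"
    and "\<P> \<subseteq> Obj C"
    and "\<forall>P\<in>\<P>. compact_object C \<kappa> P"
    and "weakly_negative C \<P>"
  shows "(let A = big_extension_closure C \<kappa> \<P>;
              B = big_extension_closure C \<kappa> (\<Union>i. shift_class C i \<P>)
          in B = star C A (shift_class C 1 B) \<and>
             (\<forall>(n::nat) (\<P>\<^sub>i :: nat \<Rightarrow> 'o set).
                \<P> = (\<Union>i\<in>{0..n}. \<P>\<^sub>i i) \<and>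
                (\<forall>i\<in>{0..n}. \<forall>j\<in>{0..n}. i \<le> j \<longrightarrow>
                   (\<forall>P\<in>\<P>\<^sub>i i. \<forall>P'\<in>\<P>\<^sub>i j. hom_vanishes C P (Sh C P'))) \<longrightarrow>
                iterated_star C (\<lambda>i. small_coproducts_of C \<kappa> (\<P>\<^sub>i i)) n = A))"
proof -
  interpret triangulated_category C by fact
  have compact: "\<And>P. P \<in> \<P> \<Longrightarrow> compact_object C \<kappa> P" using assms(5) by blast
  show ?thesis
    unfolding Let_def
  proof (intro conjI allI impI)
    show "big_extension_closure C \<kappa> (\<Union>i. shift_class C i \<P>) =
        star C (big_extension_closure C \<kappa> \<P>)
          (shift_class C 1 (big_extension_closure C \<kappa> (\<Union>i. shift_class C i \<P>)))"
      by (rule closure_eq_star_shift[OF assms(3,4) compact assms(6)])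
  next
    fix n and \<P>\<^sub>i :: "nat \<Rightarrow> 'o set"
    assume *: "\<P> = (\<Union>i\<in>{0..n}. \<P>\<^sub>i i) \<and>
      (\<forall>i\<in>{0..n}. \<forall>j\<in>{0..n}. i \<le> j \<longrightarrow>
        (\<forall>P\<in>\<P>\<^sub>i i. \<forall>P'\<in>\<P>\<^sub>i j. hom_vanishes C P (Sh C P')))"
    show "iterated_star C (\<lambda>i. small_coproducts_of C \<kappa> (\<P>\<^sub>i i)) n = big_extension_closure C \<kappa> \<P>"
    proof (rule iterated_star_eq_closure[OF assms(2-4) compact])
      show "\<P> = (\<Union>i\<in>{0..n}. \<P>\<^sub>i i)" using * by blast
      show "hom_vanishes C P (Sh C P')"
        if "i \<le> j" "j \<le> n" "P \<in> \<P>\<^sub>i i" "P' \<in> \<P>\<^sub>i j" for i j P P'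
      proof -
        have "i \<in> {0..n}" "j \<in> {0..n}" using that by simp_all
        then show ?thesis using * that by blast
      qed
    qed
  qed
qed

end
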